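(* There exists a universal constant $C$ such that the following holds for every degree statistic $\mathbf{n}$ and every tree $T\in\mathbb{T}$ ($C$ does not depend on $\mathbf{n}$ or $T$). Let $n:=|\mathbf{n}|$, $m:=|T|$, let $\mathcal{T}_{\mathbf{n}}$ be uniformly random in $\mathbb{T}_{\mathbf{n}}$, and let $\lambda:=\mathbb{E}\,N_T(\mathcal{T}_{\mathbf{n}})$. Then $$d_{\mathrm{TV}}\bigl(N_T(\mathcal{T}_{\mathbf{n}}),\mathrm{Po}(\lambda)\bigr)\le C\lambda\sum_{i\in\mathcal{D}(T)}\frac{n_T(i)^2}{n(i)}=C m^2\,\frac{\lambda}{n}\sum_{i\in\mathcal{D}(T)}\frac{p_i(\mathbf{n}_T)^2}{p_i(\mathbf{n})}.$$
   Context: $\mathbb{T}$ is the set of all finite rooted plane (ordered) trees (up to isomorphism of plane rooted trees); $|T|$ is the number of vertices of $T$, and $d_T(v)$ is the (out)degree, i.e. number of children, of $v\in T$. The degree statistic of $T$ is $\mathbf{n}_T=(n_T(i))_{i\ge 0}$ with $n_T(i)=\#\{v\in T: d_T(v)=i\}$, and $\mathcal{D}(T)=\{i\ge 0:n_T(i)>0\}$. A sequence $\mathbf{n}=(n(i))_{i\ge 0}$ of nonnegative integers is called a degree statistic if $\sum_{i\ge 0}n(i)=1+\sum_{i\ge 0}i\,n(i)<\infty$. Put $|\mathbf{n}|=\sum_i n(i)$ and $p_i(\mathbf{n})=n(i)/|\mathbf{n}|$ (in particular $p_i(\mathbf{n}_T)=n_T(i)/|T|$). $\mathbb{T}_{\mathbf{n}}$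 is the (finite, nonempty) set of plane rooted trees with degree statistic $\mathbf{n}$. For $v\in T$, the fringe tree $T_v$ is the subtree of $T$ consisting of $v$ and all its descendants, rooted at $v$. For $T,T'\in\mathbb{T}$, $N_{T'}(T)=\#\{v\in T: T_v=T'\}$, where equality means isomorphism as plane rooted trees. $\mathrm{Po}(\lambda)$ is the Poisson distribution with mean $\lambda$ ($\mathrm{Po}(0)$ is the point mass at $0$). The total variation distance between (the distributions of) $X$ and $Y$ is $d_{\mathrm{TV}}(X,Y)=\sup_A|\mathbb{P}(X\in A)-\mathbb{P}(Y\in A)|$, the supremum being over all measurable sets $A$. If $n(i)=0$ for some $i\in\mathcal{D}(T)$ then $\lambda=0$, and the bound is read with $0\cdot\infty=0$. *)

theory Defs
  imports "HOL-Probability.Probability"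
begin

text \<open>
  A finite rooted plane tree is a root together with the finite ordered list of the subtrees hanging
  off its children. Isomorphism of plane rooted trees is then equality of this datatype.
\<close>

datatype plane_tree = PNode (children: "plane_tree list")

text \<open>
  Vertices are addressed by the sequence of child indices (counted from 0) leading to them from the
  root, so that equal fringe trees at different vertices are counted separately.
\<close>

primrec is_vertex :: "nat list \<Rightarrow> plane_tree \<Rightarrow> bool" where
  "is_vertex [] t \<longleftrightarrow> True"
| "is_vertex (i # v) t \<longleftrightarrow> i < length (children t) \<and> is_vertex v (children t ! i)"

definition vertices :: "plane_tree \<Rightarrow> nat list set" where
  "vertices t = {v. is_vertex v t}"

text \<open>Only meaningful when the address is a vertex of the tree.\<close>

primrec fringe_at :: "nat list \<Rightarrow> plane_tree \<Rightarrow> plane_tree" where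
  "fringe_at [] t = t"
| "fringe_at (i # v) t = fringe_at v (children t ! i)"

definition tree_size :: "plane_tree \<Rightarrow> nat" where
  "tree_size t = card (vertices t)"

definition outdeg :: "plane_tree \<Rightarrow> nat list \<Rightarrow> nat" where
  "outdeg t v = length (children (fringe_at v t))"

definition tree_stat :: "plane_tree \<Rightarrow> nat \<Rightarrow> nat" where
  "tree_stat t i = card {v \<in> vertices t. outdeg t v = i}"

definition degree_set :: "plane_tree \<Rightarrow> nat set" where
  "degree_set t = {i. tree_stat t i > 0}"

definition fringe_count :: "plane_tree \<Rightarrow> plane_tree \<Rightarrow> nat" where
  "fringe_count t' t = card {v \<in> vertices t. fringe_at v t = t'}"

definition stat_support :: "(nat \<Rightarrow> nat) \<Rightarrow> nat set" where
  "stat_support ns = {i. ns i > 0}"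

definition stat_size :: "(nat \<Rightarrow> nat) \<Rightarrow> nat" where
  "stat_size ns = (\<Sum>i\<in>stat_support ns. ns i)"

text \<open>
  A series of natural numbers converges iff it has finite support, in which case its value is the
  sum over the support.
\<close>

definition degree_statistic :: "(nat \<Rightarrow> nat) \<Rightarrow> bool" where
  "degree_statistic ns \<longleftrightarrow>
     finite (stat_support ns) \<and> stat_size ns = 1 + (\<Sum>i\<in>stat_support ns. i * ns i)"

text \<open>
  Quotients by \<open>ns i\<close> or \<open>stat_prop ns i\<close> with \<open>ns i = 0\<close> evaluate to 0. For \<open>i\<close> in the degree set of
  \<open>t\<close> this happens only if \<open>t\<close> occurs as a fringe tree of no tree with statistic \<open>ns\<close>, so that the
  expected count multiplying the sum is 0, in agreement with reading 0 times infinity as 0.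
\<close>

definition stat_prop :: "(nat \<Rightarrow> nat) \<Rightarrow> nat \<Rightarrow> real" where
  "stat_prop ns i = real (ns i) / real (stat_size ns)"

definition trees_with_stat :: "(nat \<Rightarrow> nat) \<Rightarrow> plane_tree set" where
  "trees_with_stat ns = {t. tree_stat t = ns}"

text \<open>
  \<^const>\<open>pmf_of_set\<close> is the uniform distribution on a finite nonempty set; when \<open>ns\<close> is a degree
  statistic, the set of trees with that statistic is finite and nonempty.
\<close>

definition random_tree :: "(nat \<Rightarrow> nat) \<Rightarrow> plane_tree pmf" where
  "random_tree ns = pmf_of_set (trees_with_stat ns)"

text \<open>The library's \<^const>\<open>poisson_pmf\<close> requires a positive rate.\<close>

definition Po :: "real \<Rightarrow> nat pmf" where
  "Po r = (if r = 0 then return_pmf 0 else poisson_pmf r)"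

text \<open>Every set is measurable for a discrete distribution.\<close>

definition d_TV :: "'a pmf \<Rightarrow> 'a pmf \<Rightarrow> real" where
  "d_TV p q = (SUP A. \<bar>measure_pmf.prob p A - measure_pmf.prob q A\<bar>)"

end

theory Submission
  imports Defs "HOL-Combinatorics.Multiset_Permutations" "HOL-Library.Sublist"
begin

text \<open>
  Let \<open>w\<close> be the word of vertex degrees of \<open>T\<close> in preorder, of length \<open>m\<close>, and let \<open>M\<close> be the multiset of
  degrees prescribed by the statistic, of size \<open>n\<close>. Degree words of trees are exactly the words with
  letter sum one less than their length all of whose proper prefixes have letter sum at least their
  length; by the cycle lemma (\<open>bij_betw_rotations\<close>) every arrangement of \<open>M\<close> has exactly one rotation
  of this kind. Two occurrences of \<open>w\<close> never overlap, and fringe copies of \<open>T\<close> are occurrences of \<open>w\<close>.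
  Hence the number \<open>N\<close> of fringe copies is distributed as the number of cyclic occurrences of \<open>w\<close> in a
  uniformly random arrangement of \<open>M\<close>.

  The approximation is by the Stein-Chen method. For a set \<open>A\<close> there is a function \<open>f\<close> with
  \<open>\<lambda> f(j + 1) - j f(j) = 1\<^sub>A(j) - Po(\<lambda>)(A)\<close> whose increments on positive arguments have
  absolute value at most \<open>1/\<lambda>\<close> (\<open>stein_equation\<close>, \<open>stein_step\<close>). Rotating a marked occurrence to
  the front and cutting it off gives \<open>E[N f(N)] = \<lambda> E[f(1 + R)]\<close>, where \<open>R\<close> counts the linear occurrences of \<open>w\<close> in a uniformly random
  arrangement of the \<open>n - m\<close> letters that remain after removing those of \<open>w\<close> from \<open>M\<close>
  (\<open>size_biased_fringe_count\<close>). So the error is \<open>\<lambda> |E f(N + 1) - E f(R + 1)|\<close>, and it suffices to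
  couple \<open>N\<close> and \<open>R\<close> such that \<open>E|N - R|\<close> is of order \<open>\<lambda> S\<close>, with \<open>S\<close> the sum of \<open>n\<^sub>T(i)\<^sup>2 / n(i)\<close>.

  The coupling deletes the letters of \<open>w\<close> one at a time, each at a uniformly random position among its
  copies. A given occurrence is destroyed by the deletion of a letter \<open>i\<close> with probability about
  \<open>n\<^sub>T(i) / n(i)\<close>. Conversely the deleted letter is uniformly placed relative to the word that is
  left, so an occurrence in that word is new with probability about \<open>m/n\<close>
  (\<open>average_occs_remove_letter\<close>). Summation over the letters of \<open>w\<close> yields \<open>\<lambda> (S + m\<^sup>2/n)\<close> up to a
  constant, and \<open>m\<^sup>2/n \<le> S\<close> by the Cauchy-Schwarz inequality. Passing from cyclic to linear
  occurrences costs another \<open>\<lambda> m/n\<close>.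

  The argument needs \<open>S\<close> to be small, so that no intermediate word has many more occurrences on average
  than the first one. If \<open>S \<ge> 1/4\<close>, the bound is trivial: both distributions put mass at least
  \<open>1 - \<lambda>\<close> on 0, so their distance is at most \<open>2 \<lambda>\<close>.
\<close>

section \<open>Preorder degree words\<close>

lemma vertices_PNode:
  "vertices (PNode ts) = insert [] (\<Union>i<length ts. (#) i ` vertices (ts ! i))"
proof -
  have "v \<in> vertices (PNode ts) \<longleftrightarrow> v \<in> insert [] (\<Union>i<length ts. (#) i ` vertices (ts ! i))" for v
    by (cases v) (auto simp: vertices_def)
  then show ?thesis by blast
qed

lemma finite_vertices: "finite (vertices t)"
  by (induction t) (simp add: vertices_PNode)

text \<open>
  One recursion for all statistics of fringe trees: the choices of \<open>P\<close> give the size, the degree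
  counts and the number of fringe copies of a fixed tree.
\<close>

lemma card_fringe_PNode:
  "card {v \<in> vertices (PNode ts). P (fringe_at v (PNode ts))} =
     of_bool (P (PNode ts)) + (\<Sum>t\<leftarrow>ts. card {v \<in> vertices t. P (fringe_at v t)})"
proof -
  let ?F = "\<lambda>t. {v \<in> vertices t. P (fringe_at v t)}"
  let ?U = "\<Union>i<length ts. (#) i ` ?F (ts ! i)"
  have split: "?F (PNode ts) = (if P (PNode ts) then {[]} else {}) \<union> ?U"
    by (auto simp: vertices_PNode)
  have fin: "finite (?F t)" for t
    using finite_vertices by simp
  have "card ?U = (\<Sum>i<length ts. card ((#) i ` ?F (ts ! i)))"
    using fin by (intro card_UN_disjoint) auto
  also have "\<dots> = (\<Sum>i<length ts. card (?F (ts ! i)))"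
    by (intro sum.cong refl card_image) auto
  also have "\<dots> = (\<Sum>t\<leftarrow>ts. card (?F t))"
    by (simp add: sum_list_sum_nth atLeast0LessThan)
  finally have U: "card ?U = (\<Sum>t\<leftarrow>ts. card (?F t))" .
  have "card (?F (PNode ts)) = card (if P (PNode ts) then {[] :: nat list} else {}) + card ?U"
    unfolding split using fin by (intro card_Un_disjoint) auto
  then show ?thesis
    using U by simp
qed

fun preorder_word :: "plane_tree \<Rightarrow> nat list" where
  "preorder_word (PNode ts) = length ts # concat (map preorder_word ts)"

abbreviation forest_word :: "plane_tree list \<Rightarrow> nat list" where
  "forest_word ts \<equiv> concat (map preorder_word ts)"

lemma preorder_word_ne [simp]: "preorder_word t \<noteq> []"
  by (cases t) simp

lemma tree_size_eq_length: "tree_size t = length (preorder_word t)"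
proof (induction t)
  case (PNode ts)
  have "tree_size (PNode ts) = 1 + (\<Sum>t\<leftarrow>ts. tree_size t)"
    using card_fringe_PNode[of ts "\<lambda>_. True"] by (simp add: tree_size_def)
  also have "(\<Sum>t\<leftarrow>ts. tree_size t) = (\<Sum>t\<leftarrow>ts. length (preorder_word t))"
    using PNode by (simp cong: map_cong)
  finally show ?case by (simp add: length_concat o_def)
qed

lemma tree_stat_eq_count: "tree_stat t i = count (mset (preorder_word t)) i"
proof (induction t)
  case (PNode ts)
  have "tree_stat (PNode ts) i = of_bool (length ts = i) + (\<Sum>t\<leftarrow>ts. tree_stat t i)"
    using card_fringe_PNode[of ts "\<lambda>s. length (children s) = i"]
    by (simp add: tree_stat_def outdeg_def)
  also have "(\<Sum>t\<leftarrow>ts. tree_stat t i) = (\<Sum>t\<leftarrow>ts. count (mset (preorder_word t)) i)"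
    using PNode by (simp cong: map_cong)
  also have "\<dots> = count (mset (forest_word ts)) i"
    by (induction ts) auto
  finally show ?case by simp
qed

section \<open>Lukasiewicz words\<close>

text \<open>
  The height at which a word ends, read as a lattice path whose letter \<open>x\<close> is a step \<open>x - 1\<close>. For the
  degrees of a nonempty initial segment of a preorder traversal, this is the number of children that
  are announced and not yet visited, minus one.
\<close>

definition excess :: "nat list \<Rightarrow> int" where
  "excess u = (\<Sum>x\<leftarrow>u. int x - 1)"

lemma excess_simps [simp]:
  "excess [] = 0" "excess (x # u) = int x - 1 + excess u" "excess (u @ v) = excess u + excess v"
  by (simp_all add: excess_def)

definition lukasiewicz :: "nat list \<Rightarrow> bool" where
  "lukasiewicz u \<longleftrightarrow> excess u = -1 \<and> (\<forall>a b. u = a @ b \<longrightarrow> b \<noteq> [] \<longrightarrow> 0 \<le> excess a)"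

lemma lukasiewicz_ne: "lukasiewicz u \<Longrightarrow> u \<noteq> []"
  by (auto simp: lukasiewicz_def)

text \<open>
  As a nonempty suffix of a Lukasiewicz word, \<open>s\<close> has negative excess; as a proper prefix of such a
  word, it has not.
\<close>

lemma lukasiewicz_no_overlap:
  assumes "lukasiewicz (a @ s)" "lukasiewicz (s @ b)" "s \<noteq> []" "b \<noteq> []"
  shows False
proof -
  have "0 \<le> excess a" "excess a + excess s = -1" "0 \<le> excess s"
    using assms by (auto simp: lukasiewicz_def)
  then show False by simp
qed

text \<open>
  The path of a forest is a concatenation of paths that each descend by one, and each reaches its final
  level only at its end.
\<close>

lemma excess_forest_word:
  assumes "\<And>t. t \<in> set ts \<Longrightarrow> lukasiewicz (preorder_word t)"
  shows "excess (forest_word ts) = - int (length ts)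
    \<and> (\<forall>a b. forest_word ts = a @ b \<longrightarrow> b \<noteq> [] \<longrightarrow> - int (length ts) < excess a)"
  using assms
proof (induction ts)
  case (Cons t ts)
  have t: "lukasiewicz (preorder_word t)" and
    ts: "excess (forest_word ts) = - int (length ts)"
    "\<And>a b. forest_word ts = a @ b \<Longrightarrow> b \<noteq> [] \<Longrightarrow> - int (length ts) < excess a"
    using Cons by auto
  have "- int (length (t # ts)) < excess a"
    if "preorder_word t @ forest_word ts = a @ b" "b \<noteq> []" for a b
  proof -
    from that(1) consider (l) c where "preorder_word t = a @ c" "c \<noteq> []"
      | (r) c where "a = preorder_word t @ c" "forest_word ts = c @ b"
      unfolding append_eq_append_conv2 by fastforce
    then show ?thesis
    proof cases
      case l
      then have "0 \<le> excess a" using t by (auto simp: lukasiewicz_def)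
      then show ?thesis by simp
    next
      case r
      then show ?thesis using ts(2)[OF r(2) that(2)] t by (simp add: lukasiewicz_def)
    qed
  qed
  then show ?case using t ts(1) by (auto simp: lukasiewicz_def)
qed simp

lemma lukasiewicz_preorder_word: "lukasiewicz (preorder_word t)"
proof (induction t)
  case (PNode ts)
  note forest = excess_forest_word[OF PNode]
  show ?case
    unfolding lukasiewicz_def
  proof (intro conjI allI impI)
    show "excess (preorder_word (PNode ts)) = -1"
      using forest by simp
    fix a b
    assume ab: "preorder_word (PNode ts) = a @ b" "b \<noteq> []"
    show "0 \<le> excess a"
    proof (cases a)
      case (Cons x a')
      then have "x = length ts" "forest_word ts = a' @ b" using ab by auto
      then show ?thesis using forest ab(2) Cons by fastforce
    qed simp
  qed
qed

text \<open>
  The letter \<open>x\<close> at the front opens a vertex that takes the first \<open>x\<close> trees of the remaining forest as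
  its children. Generalizing from one tree to \<open>k\<close> trees is what makes this recursion go through.
\<close>

lemma forest_word_surj:
  assumes "excess u = - int k" "\<And>a b. u = a @ b \<Longrightarrow> b \<noteq> [] \<Longrightarrow> - int k < excess a"
  shows "\<exists>ts. length ts = k \<and> forest_word ts = u"
  using assms
proof (induction u arbitrary: k)
  case (Cons x u)
  have k: "0 < k" using Cons.prems(2)[of "[]" "x # u"] by simp
  have "\<exists>ts. length ts = k - 1 + x \<and> forest_word ts = u"
  proof (rule Cons.IH)
    show "excess u = - int (k - 1 + x)" using Cons.prems(1) k by simp
    show "- int (k - 1 + x) < excess a" if "u = a @ b" "b \<noteq> []" for a b
      using Cons.prems(2)[of "x # a" b] that k by simp
  qed
  then obtain ts where ts: "length ts = k - 1 + x" "forest_word ts = u" by blast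
  have "forest_word ts = forest_word (take x ts) @ forest_word (drop x ts)"
    by (metis append_take_drop_id concat_append map_append)
  then have "forest_word (PNode (take x ts) # drop x ts) = x # u"
    using ts by simp
  moreover have "length (PNode (take x ts) # drop x ts) = k"
    using ts k by simp
  ultimately show ?case by blast
qed simp

lemma lukasiewicz_imp_preorder_word:
  assumes "lukasiewicz u"
  shows "\<exists>t. preorder_word t = u"
proof -
  obtain ts where ts: "length ts = 1" "forest_word ts = u"
    using forest_word_surj[of u 1] assms unfolding lukasiewicz_def by fastforce
  then show ?thesis by (cases ts) auto
qed

text \<open>
  Opening the first root turns two forests with the same word into two forests with the same shorter
  word; the trailing words \<open>r\<close> and \<open>r'\<close> make the result apply to prefixes.
\<close>

lemma forest_word_inj:
  assumes "forest_word ts @ r = forest_word ts' @ r'" "length ts = length ts'"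
  shows "ts = ts'"
  using assms
proof (induction "length (forest_word ts @ r)" arbitrary: ts ts' rule: less_induct)
  case less
  show ?case
  proof (cases ts)
    case Nil
    then show ?thesis using less.prems by simp
  next
    case (Cons t ss)
    then obtain t' ss' where ts': "ts' = t' # ss'" using less.prems(2) by (cases ts') auto
    obtain cs where cs: "t = PNode cs" by (cases t)
    obtain cs' where cs': "t' = PNode cs'" by (cases t')
    have "length cs = length cs'" "forest_word (cs @ ss) @ r = forest_word (cs' @ ss') @ r'"
      using less.prems(1) by (simp_all add: Cons ts' cs cs')
    moreover from this have "cs @ ss = cs' @ ss'"
      using less.prems(2) by (intro less.hyps) (simp_all add: Cons ts' cs cs')
    ultimately show ?thesis by (simp add: Cons ts' cs cs')
  qed
qed

lemma preorder_word_prefix_free: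
  assumes "prefix (preorder_word t) (preorder_word t' @ r)"
  shows "t = t'"
proof -
  obtain q where "forest_word [t'] @ r = forest_word [t] @ q"
    using assms by (auto simp: prefix_def)
  from forest_word_inj[OF this] show ?thesis by simp
qed

section \<open>Occurrences of a pattern\<close>

definition occs :: "nat list \<Rightarrow> nat list \<Rightarrow> nat set" where
  "occs w u = {k. prefix w (drop k u)}"

lemma occs_bound: "k \<in> occs w u \<Longrightarrow> w \<noteq> [] \<Longrightarrow> k + length w \<le> length u"
  by (cases "k < length u") (auto simp: occs_def dest: prefix_length_le)

lemma finite_occs: "w \<noteq> [] \<Longrightarrow> finite (occs w u)"
  by (rule finite_subset[of _ "{..length u}"]) (auto dest: occs_bound)

lemma occs_Nil: "w \<noteq> [] \<Longrightarrow> occs w [] = {}"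
  by (auto simp: occs_def)

lemma card_occs_Cons:
  assumes "w \<noteq> []"
  shows "card (occs w (x # u)) = of_bool (prefix w (x # u)) + card (occs w u)"
proof -
  have "k \<in> occs w (x # u) \<longleftrightarrow> k \<in> (if prefix w (x # u) then {0} else {}) \<union> Suc ` occs w u" for k
    by (cases k) (auto simp: occs_def)
  then have "occs w (x # u) = (if prefix w (x # u) then {0} else {}) \<union> Suc ` occs w u"
    by blast
  moreover have "card \<dots> = card (if prefix w (x # u) then {0 :: nat} else {}) + card (Suc ` occs w u)"
    using finite_occs[OF assms] by (intro card_Un_disjoint) auto
  ultimately show ?thesis by (simp add: card_image)
qed

text \<open>
  If no nonempty suffix of \<open>u\<close> is a proper prefix of the pattern, no occurrence crosses the junction.
\<close>

lemma card_occs_append: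
  assumes "w \<noteq> []" "\<And>s r. suffix s u \<Longrightarrow> s \<noteq> [] \<Longrightarrow> w = s @ r \<Longrightarrow> r = []"
  shows "card (occs w (u @ v)) = card (occs w u) + card (occs w v)"
  using assms(2)
proof (induction u)
  case Nil
  then show ?case using assms(1) by (simp add: occs_Nil)
next
  case (Cons x u)
  have "prefix w ((x # u) @ v) \<longleftrightarrow> prefix w (x # u)"
    using Cons.prems[of "x # u"] unfolding prefix_append by auto
  moreover have "card (occs w (u @ v)) = card (occs w u) + card (occs w v)"
    using Cons.prems by (intro Cons.IH) (metis suffix_Cons)
  ultimately show ?case by (simp add: card_occs_Cons assms(1))
qed

text \<open>
  By \<open>lukasiewicz_no_overlap\<close> an occurrence cannot run from one subtree into the next, so occurrences
  obey the same recursion as fringe copies; an occurrence at the very front fills the whole word, as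
  degree words of trees form a prefix-free code.
\<close>

lemma fringe_count_eq_occs: "fringe_count T t = card (occs (preorder_word T) (preorder_word t))"
proof (induction t)
  case (PNode ts)
  let ?w = "preorder_word T"
  have no_cross: "card (occs ?w (preorder_word t @ v)) =
      card (occs ?w (preorder_word t)) + card (occs ?w v)" for t v
  proof (rule card_occs_append)
    fix s r
    assume "suffix s (preorder_word t)" "s \<noteq> []" "?w = s @ r"
    then show "r = []"
      using lukasiewicz_no_overlap lukasiewicz_preorder_word by (metis suffixE)
  qed simp
  have forest: "card (occs ?w (forest_word us)) = (\<Sum>t\<leftarrow>us. card (occs ?w (preorder_word t)))" for us
    by (induction us) (simp_all add: occs_Nil no_cross)
  have root: "prefix ?w (preorder_word (PNode ts)) \<longleftrightarrow> PNode ts = T"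
    using preorder_word_prefix_free[of T "PNode ts" "[]"] by auto
  have "fringe_count T (PNode ts) = of_bool (PNode ts = T) + (\<Sum>t\<leftarrow>ts. fringe_count T t)"
    using card_fringe_PNode[of ts "\<lambda>s. s = T"] by (simp add: fringe_count_def)
  also have "(\<Sum>t\<leftarrow>ts. fringe_count T t) = (\<Sum>t\<leftarrow>ts. card (occs ?w (preorder_word t)))"
    using PNode by (simp cong: map_cong)
  finally show ?case
    using root by (simp add: card_occs_Cons forest)
qed

section \<open>The cycle lemma\<close>

text \<open>
  If both parts were nonempty, each would be a proper prefix of a Lukasiewicz word and so of excess at
  least 0, although their excesses add up to -1.
\<close>

lemma lukasiewicz_rotation_unique:
  assumes "lukasiewicz (a @ b)" "lukasiewicz (b @ a)"
  shows "a = [] \<or> b = []"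
proof (rule ccontr)
  assume "\<not> ?thesis"
  then have "0 \<le> excess a" "0 \<le> excess b" "excess a + excess b = -1"
    using assms by (auto simp: lukasiewicz_def)
  then show False by simp
qed

text \<open>
  Start the word where its path attains its minimum for the first time.
\<close>

lemma lukasiewicz_rotation_exists:
  assumes "excess u = -1"
  shows "\<exists>a b. u = a @ b \<and> b \<noteq> [] \<and> lukasiewicz (b @ a)"
proof -
  define S where "S k = excess (take k u)" for k
  let ?n = "length u"
  have ends: "S 0 = 0" "S ?n = -1" using assms by (simp_all add: S_def)
  have n: "0 < ?n" using assms by (cases u) auto
  define \<mu> where "\<mu> = Min (S ` {..?n})"
  have \<mu>_le: "\<mu> \<le> S k" if "k \<le> ?n" for k
    unfolding \<mu>_def using that by (intro Min_le) auto
  have "\<mu> \<in> S ` {..?n}" unfolding \<mu>_def by (intro Min_in) auto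
  then have ex: "\<exists>k. k \<le> ?n \<and> S k = \<mu>" by auto
  \<comment> \<open>The first minimum: later positions are not lower, earlier ones are strictly higher. The strict
    inequality compensates for the descent by one over a full period.\<close>
  define k where "k = (LEAST k. k \<le> ?n \<and> S k = \<mu>)"
  have k: "k \<le> ?n" "S k = \<mu>"
    using LeastI_ex[OF ex] unfolding k_def by auto
  have first: "\<mu> < S j" if "j < k" for j
    using not_less_Least[of j "\<lambda>k. k \<le> ?n \<and> S k = \<mu>"] \<mu>_le[of j] that k(1)
    unfolding k_def by force
  define a where "a = take k u"
  define b where "b = drop k u"
  have u: "u = a @ b" by (simp add: a_def b_def)
  have len: "length a = k" using k(1) by (simp add: a_def)
  have "k \<noteq> 0" using \<mu>_le[of ?n] ends k(2)
    by (metis le_refl neg_le_0_iff_le not_one_le_zero le_minus_one_simps(3))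
  have "0 \<le> excess c" if split: "b @ a = c @ d" "d \<noteq> []" for c d
  proof -
    from split(1) consider (l) e where "b = c @ e" "d = e @ a"
      | (r) e where "c = b @ e" "a = e @ d"
      unfolding append_eq_append_conv2 by auto
    then show ?thesis
    proof cases
      case l
      have "take (k + length c) u = a @ c"
        unfolding u l len[symmetric] by simp
      then have "S (k + length c) = excess a + excess c"
        by (simp add: S_def)
      moreover have "k + length c \<le> ?n"
        using arg_cong[OF l(1), of length] k(1) by (simp add: b_def)
      ultimately show ?thesis using \<mu>_le[of "k + length c"] k(2) by (simp add: S_def a_def)
    next
      case r
      have "take (length e) u = e" unfolding u r by simp
      then have "S (length e) = excess e" by (simp add: S_def)
      moreover have "length e < k" using r split(2) len by auto
      ultimately have "excess a < excess e"
        using first[of "length e"] k(2) by (simp add: S_def a_def)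
      moreover have "excess a + excess b = -1" using assms u by simp
      ultimately show ?thesis using r by simp
    qed
  qed
  moreover have "excess (b @ a) = -1" using assms u by simp
  ultimately have luk: "lukasiewicz (b @ a)" by (auto simp: lukasiewicz_def)
  show ?thesis
  proof (cases "b = []")
    case True
    then show ?thesis using luk u n by (intro exI[of _ "[]"] exI[of _ u]) auto
  qed (use luk u in blast)
qed

lemma rotation_split:
  assumes "k < length u"
  obtains a b where "u = a @ b" "length a = k" "b \<noteq> []" "rotate k u = b @ a"
proof
  show "u = take k u @ drop k u" by simp
  show "length (take k u) = k" "drop k u \<noteq> []" using assms by auto
  show "rotate k u = drop k u @ take k u" using assms by (simp add: rotate_drop_take)
qed

lemma mset_rotate [simp]: "mset (rotate k u) = mset u"
proof -
  have "mset (rotate1 v) = mset v" for v :: "'a list" by (cases v) simp_all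
  then show ?thesis by (induction k) simp_all
qed

lemma rotate_inj: "rotate k u = rotate k v \<Longrightarrow> u = v"
  by (induction k) (auto dest: injD[OF inj_rotate1])

lemma excess_mset: "excess u = (\<Sum>x\<in>#mset u. int x - 1)"
  by (simp add: excess_def sum_mset_sum_list[symmetric])

abbreviation words_with :: "nat multiset \<Rightarrow> nat list set" where
  "words_with \<equiv> permutations_of_multiset"

definition trees_with :: "nat multiset \<Rightarrow> plane_tree set" where
  "trees_with M = {t. mset (preorder_word t) = M}"

text \<open>
  The cycle lemma: a uniformly random word with letters \<open>M\<close> is a uniformly random rotation of the word
  of a uniformly random tree.
\<close>

lemma bij_betw_rotations:
  assumes "(\<Sum>x\<in>#M. int x - 1) = -1"
  shows "bij_betw (\<lambda>(t, k). rotate k (preorder_word t))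
     (trees_with M \<times> {..<size M}) (words_with M)"
  unfolding bij_betw_def
proof
  have aux: "t = t' \<and> k = k'"
    if eq: "rotate k (preorder_word t) = rotate k' (preorder_word t')" and
      M: "mset (preorder_word t) = M" "mset (preorder_word t') = M" and
      k: "k \<le> k'" "k' < size M" for t t' k k'
  proof -
    have len: "length (preorder_word t') = size M" using M(2) by auto
    define j where "j = k' - k"
    have "rotate k (preorder_word t) = rotate k (rotate j (preorder_word t'))"
      using eq k(1) by (simp add: rotate_rotate j_def)
    then have eq': "preorder_word t = rotate j (preorder_word t')"
      by (rule rotate_inj)
    have "j < length (preorder_word t')" using k len by (simp add: j_def)
    then obtain a b where ab: "preorder_word t' = a @ b" "length a = j" "b \<noteq> []"
      "rotate j (preorder_word t') = b @ a"
      by (rule rotation_split)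
    have "a = [] \<or> b = []"
      using lukasiewicz_rotation_unique lukasiewicz_preorder_word eq' ab by metis
    then have j: "j = 0" using ab by auto
    then have "preorder_word t = preorder_word t'" using eq' by simp
    then have "t = t'" using preorder_word_prefix_free[of t t' "[]"] by simp
    then show ?thesis using j k by (simp add: j_def)
  qed
  show "inj_on (\<lambda>(t, k). rotate k (preorder_word t))
     (trees_with M \<times> {..<size M})"
  proof (rule inj_onI)
    fix p p' :: "plane_tree \<times> nat"
    assume p: "p \<in> trees_with M \<times> {..<size M}"
      "p' \<in> trees_with M \<times> {..<size M}"
      "(\<lambda>(t, k). rotate k (preorder_word t)) p = (\<lambda>(t, k). rotate k (preorder_word t)) p'"
    obtain t k t' k' where tk: "p = (t, k)" "p' = (t', k')" by (cases p, cases p')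
    have M: "mset (preorder_word t) = M" "mset (preorder_word t') = M" "k < size M" "k' < size M"
      and eq: "rotate k (preorder_word t) = rotate k' (preorder_word t')"
      using p by (simp_all add: tk trees_with_def)
    show "p = p'"
    proof (cases "k \<le> k'")
      case True
      then show ?thesis using aux[OF eq M(1,2) True M(4)] tk by simp
    next
      case False
      then have "k' \<le> k" by simp
      then show ?thesis using aux[OF eq[symmetric] M(2,1) _ M(3)] tk by simp
    qed
  qed
  show "(\<lambda>(t, k). rotate k (preorder_word t)) ` (trees_with M \<times> {..<size M})
     = words_with M"
  proof (intro equalityI subsetI)
    fix u assume "u \<in> words_with M"
    then have u: "mset u = M" by (simp add: permutations_of_multiset_def)
    then obtain a b where ab: "u = a @ b" "b \<noteq> []" "lukasiewicz (b @ a)"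
      using lukasiewicz_rotation_exists[of u] assms excess_mset by metis
    then obtain t where t: "preorder_word t = b @ a"
      using lukasiewicz_imp_preorder_word by blast
    show "u \<in> (\<lambda>(t, k). rotate k (preorder_word t)) `
        (trees_with M \<times> {..<size M})"
    proof (cases "a = []")
      case True
      then show ?thesis using t u ab
        by (intro image_eqI[of _ _ "(t, 0)"]) (auto simp: trees_with_def)
    next
      case False
      then show ?thesis using t u ab
        by (intro image_eqI[of _ _ "(t, length b)"]) (auto simp: rotate_append trees_with_def)
    qed
  qed (auto simp: permutations_of_multiset_def trees_with_def)
qed

section \<open>Cyclic occurrences\<close>

definition cyclic_occs :: "nat list \<Rightarrow> nat list \<Rightarrow> nat set" where
  "cyclic_occs w u = {k. k < length u \<and> prefix w (rotate k u)}"

lemma finite_cyclic_occs: "finite (cyclic_occs w u)"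
  by (auto simp: cyclic_occs_def)

lemma card_cyclic_occs_rotate1: "card (cyclic_occs w (rotate1 u)) = card (cyclic_occs w u)"
proof (cases "u = []")
  case False
  let ?n = "length u"
  have pos: "0 < ?n" using False by simp
  have rot: "rotate k (rotate1 u) = rotate (Suc k mod ?n) u" for k
    by (metis rotate_Suc rotate1_rotate_swap rotate_conv_mod)
  have "bij_betw (\<lambda>k. Suc k mod ?n) {..<?n} {..<?n}"
  proof -
    have "inj_on (\<lambda>k. Suc k mod ?n) {..<?n}"
      by (auto simp: inj_on_def mod_Suc split: if_splits)
    moreover have "(\<lambda>k. Suc k mod ?n) ` {..<?n} \<subseteq> {..<?n}" using pos by auto
    ultimately show ?thesis by (simp add: bij_betw_def endo_inj_surj)
  qed
  then have "(\<Sum>k<?n. of_bool (prefix w (rotate (Suc k mod ?n) u)))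
      = (\<Sum>k<?n. of_bool (prefix w (rotate k u)) :: nat)"
    by (rule sum.reindex_bij_betw)
  then show ?thesis
    by (simp add: cyclic_occs_def sum_of_bool_eq rot Int_def)
qed simp

lemma card_cyclic_occs_rotate: "card (cyclic_occs w (rotate k u)) = card (cyclic_occs w u)"
  by (induction k) (simp_all add: card_cyclic_occs_rotate1)

lemma occs_subset_cyclic_occs:
  assumes "w \<noteq> []"
  shows "occs w u \<subseteq> cyclic_occs w u"
proof
  fix k assume k: "k \<in> occs w u"
  then have "k < length u" using occs_bound[OF k assms] assms by (cases w) auto
  moreover from this have "rotate k u = drop k u @ take k u" by (simp add: rotate_drop_take)
  ultimately show "k \<in> cyclic_occs w u" using k by (simp add: occs_def cyclic_occs_def)
qed

text \<open>
  An occurrence that crosses the end of \<open>u\<close> would begin with a nonempty suffix of \<open>u\<close> and continue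
  beyond it, which \<open>lukasiewicz_no_overlap\<close> excludes.
\<close>

lemma cyclic_occs_lukasiewicz:
  assumes "lukasiewicz w" "lukasiewicz u"
  shows "cyclic_occs w u = occs w u"
proof
  show "occs w u \<subseteq> cyclic_occs w u"
    using occs_subset_cyclic_occs lukasiewicz_ne assms by blast
  show "cyclic_occs w u \<subseteq> occs w u"
  proof
    fix k assume "k \<in> cyclic_occs w u"
    then have k: "k < length u" "prefix w (rotate k u)" by (auto simp: cyclic_occs_def)
    from k(1) obtain a b where ab: "u = a @ b" "length a = k" "b \<noteq> []" "rotate k u = b @ a"
      by (rule rotation_split)
    have "prefix w b"
    proof (rule ccontr)
      assume "\<not> prefix w b"
      then obtain c where "w = b @ c" "c \<noteq> []"
        using k(2) ab(4) by (auto simp: prefix_append)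
      then show False using lukasiewicz_no_overlap assms ab by metis
    qed
    then show "k \<in> occs w u" using ab by (auto simp: occs_def)
  qed
qed

text \<open>
  No other occurrence overlaps the leading copy of \<open>w\<close>, neither from the right nor around the end of
  the word; all remaining ones therefore lie inside \<open>v\<close> and are linear.
\<close>

lemma card_cyclic_occs_self_append:
  assumes "lukasiewicz w"
  shows "card (cyclic_occs w (w @ v)) = Suc (card (occs w v))"
proof -
  let ?m = "length w"
  have "cyclic_occs w (w @ v) = insert 0 ((+) ?m ` occs w v)"
  proof (intro equalityI subsetI)
    fix k assume "k \<in> cyclic_occs w (w @ v)"
    then have k: "k < length (w @ v)" "prefix w (rotate k (w @ v))" by (auto simp: cyclic_occs_def)
    from k(1) obtain a b where ab: "w @ v = a @ b" "length a = k" "b \<noteq> []"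
      "rotate k (w @ v) = b @ a"
      by (rule rotation_split)
    show "k \<in> insert 0 ((+) ?m ` occs w v)"
    proof (cases "k < ?m")
      case True
      then obtain c where c: "w = a @ c" "b = c @ v" "c \<noteq> []"
        using ab(1,2) by (auto simp: append_eq_append_conv2)
      have "a = []"
      proof (rule ccontr)
        assume "a \<noteq> []"
        obtain d where d: "w = c @ d"
        proof -
          have "prefix w (c @ (v @ a))" "prefix c (c @ (v @ a))" using k(2) ab(4) c(2) by simp_all
          moreover have "length c \<le> length w" using c(1) by simp
          ultimately have "prefix c w" using prefix_length_prefix by blast
          then show ?thesis using that by (auto simp: prefix_def)
        qed
        have "length d = length a"
          using arg_cong[OF c(1), of length] arg_cong[OF d, of length] by simp
        then have "d \<noteq> []" using \<open>a \<noteq> []\<close> by auto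
        then show False using lukasiewicz_no_overlap[of a c d] assms c(1,3) d by metis
      qed
      then show ?thesis using ab(2) by simp
    next
      case False
      then obtain c where c: "a = w @ c" "v = c @ b"
        using ab(1,2) by (auto simp: append_eq_append_conv2)
      have "prefix w b"
      proof (rule ccontr)
        assume "\<not> prefix w b"
        moreover have "prefix w (b @ (w @ c))"
          using k(2) ab(4) c(1) by simp
        ultimately obtain d where d: "w = b @ d" "prefix d (w @ c)"
          using prefix_append[of w b "w @ c"] by blast
        then have "d \<noteq> []" using \<open>\<not> prefix w b\<close> by (metis append_Nil2 prefix_order.refl)
        have "length d \<le> length w" using d(1) by simp
        then have "prefix d w" using prefix_length_prefix[OF d(2), of w] by simp
        then obtain e where e: "w = d @ e" by (auto simp: prefix_def)
        have "length e = length b"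
          using arg_cong[OF d(1), of length] arg_cong[OF e, of length] by simp
        then have "e \<noteq> []" using ab(3) by auto
        then show False using lukasiewicz_no_overlap[of b d e] assms d(1) \<open>d \<noteq> []\<close> e by metis
      qed
      then have "length c \<in> occs w v" using c by (simp add: occs_def)
      moreover have "k = ?m + length c" using ab(2) c by simp
      ultimately show ?thesis by blast
    qed
  next
    fix k assume "k \<in> insert 0 ((+) ?m ` occs w v)"
    then consider "k = 0" | j where "k = ?m + j" "j \<in> occs w v" by auto
    then show "k \<in> cyclic_occs w (w @ v)"
    proof cases
      case 1
      then show ?thesis using lukasiewicz_ne[OF assms] by (simp add: cyclic_occs_def)
    next
      case 2
      then have "k \<in> occs w (w @ v)" by (simp add: occs_def)
      then show ?thesis using occs_subset_cyclic_occs lukasiewicz_ne[OF assms] by blast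
    qed
  qed
  moreover have "0 \<notin> (+) ?m ` occs w v" using lukasiewicz_ne[OF assms] by auto
  ultimately show ?thesis
    using finite_occs lukasiewicz_ne[OF assms] by (simp add: card_image)
qed

section \<open>Averages over trees and over words\<close>

definition average :: "'a set \<Rightarrow> ('a \<Rightarrow> real) \<Rightarrow> real" where
  "average A g = (\<Sum>a\<in>A. g a) / real (card A)"

lemma average_mono:
  assumes "\<And>a. a \<in> A \<Longrightarrow> g a \<le> h a"
  shows "average A g \<le> average A h"
  unfolding average_def using assms by (intro divide_right_mono sum_mono) auto

lemma average_nonneg: "(\<And>a. a \<in> A \<Longrightarrow> 0 \<le> g a) \<Longrightarrow> 0 \<le> average A g"
  unfolding average_def by (intro divide_nonneg_nonneg sum_nonneg) auto

lemma average_cong: "(\<And>a. a \<in> A \<Longrightarrow> g a = h a) \<Longrightarrow> average A g = average A h"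
  by (simp add: average_def)

lemma average_add: "average A (\<lambda>a. g a + h a) = average A g + average A h"
  by (simp add: average_def sum.distrib add_divide_distrib)

lemma average_cmult: "average A (\<lambda>a. c * g a) = c * average A g"
  by (simp add: average_def sum_distrib_left[symmetric])

lemma average_diff: "average A (\<lambda>a. g a - h a) = average A g - average A h"
  by (simp add: average_def sum_subtractf diff_divide_distrib)

lemma abs_average_le: "\<bar>average A g\<bar> \<le> average A (\<lambda>a. \<bar>g a\<bar>)"
  by (simp add: average_def divide_right_mono sum_abs)

lemma average_const: "finite A \<Longrightarrow> A \<noteq> {} \<Longrightarrow> average A (\<lambda>_. c) = c"
  by (simp add: average_def)

lemma card_words_pos: "0 < real (card (words_with M))"
  by (simp add: card_gt_0_iff)

lemma sum_over_rotations:
  fixes g :: "nat list \<Rightarrow> real"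
  assumes "(\<Sum>x\<in>#M. int x - 1) = -1"
  shows "(\<Sum>u\<in>words_with M. g u) =
    (\<Sum>t\<in>trees_with M. \<Sum>k<size M. g (rotate k (preorder_word t)))"
proof -
  have "(\<Sum>u\<in>words_with M. g u) =
      (\<Sum>(t, k)\<in>trees_with M \<times> {..<size M}. g (rotate k (preorder_word t)))"
    using sum.reindex_bij_betw[OF bij_betw_rotations[OF assms], of g]
    by (simp add: case_prod_unfold)
  then show ?thesis by (simp add: sum.cartesian_product)
qed

lemma size_pos_if_excess:
  assumes "(\<Sum>x\<in>#M. int x - 1) = -1"
  shows "0 < size M"
  using assms by (cases "M = {#}") (auto simp: nonempty_has_size)

lemma finite_trees_with:
  assumes "(\<Sum>x\<in>#M. int x - 1) = -1"
  shows "finite (trees_with M)" and "trees_with M \<noteq> {}"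
proof -
  note bij = bij_betw_rotations[OF assms]
  have fin: "finite (trees_with M \<times> {..<size M})"
    using bij_betw_finite[OF bij] by simp
  moreover have ne: "{..<size M} \<noteq> {}"
    using size_pos_if_excess[OF assms] by auto
  ultimately show "finite (trees_with M)" by (rule finite_cartesian_productD1)
  show "trees_with M \<noteq> {}"
    using bij permutations_of_multiset_not_empty[of M]
    by (metis Sigma_empty1 bij_betw_def image_empty)
qed

lemma card_words_eq_size_times_trees:
  assumes "(\<Sum>x\<in>#M. int x - 1) = -1"
  shows "real (card (words_with M)) = real (size M) * real (card (trees_with M))"
  using sum_over_rotations[OF assms, of "\<lambda>_. 1"] by simp

lemma average_words_eq_average_trees:
  assumes M: "(\<Sum>x\<in>#M. int x - 1) = -1"
    and g: "\<And>t k. t \<in> trees_with M \<Longrightarrow> g (rotate k (preorder_word t)) = G t"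
  shows "average (words_with M) g = average (trees_with M) G"
proof -
  have "(\<Sum>u\<in>words_with M. g u) = (\<Sum>t\<in>trees_with M. real (size M) * G t)"
    unfolding sum_over_rotations[OF M] using g by simp
  then show ?thesis
    using size_pos_if_excess[OF M] unfolding nonempty_has_size[symmetric]
    by (simp add: average_def card_words_eq_size_times_trees[OF M] sum_distrib_left[symmetric])
qed

lemma fringe_count_eq_cyclic_occs:
  "card (cyclic_occs (preorder_word T) (rotate k (preorder_word t))) = fringe_count T t"
  by (simp add: card_cyclic_occs_rotate cyclic_occs_lukasiewicz lukasiewicz_preorder_word
      fringe_count_eq_occs)

text \<open>
  Among the rotations of the word of \<open>t\<close>, exactly one starts with each of the copies of the pattern, and
  the cyclic count is the same for all of them.
\<close>

lemma sum_words_starting_with: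
  assumes "(\<Sum>x\<in>#M. int x - 1) = -1"
  shows "(\<Sum>u\<in>words_with M. of_bool (prefix (preorder_word T) u) *
      F (card (cyclic_occs (preorder_word T) u)))
    = (\<Sum>t\<in>trees_with M. real (fringe_count T t) * F (fringe_count T t))"
  unfolding sum_over_rotations[OF assms] fringe_count_eq_cyclic_occs
    sum_distrib_right[symmetric]
proof (intro sum.cong refl arg_cong2[where f = "(*)"])
  fix t assume "t \<in> trees_with M"
  then have "length (preorder_word t) = size M" by (auto simp: trees_with_def)
  then have "(\<Sum>k<size M. of_bool (prefix (preorder_word T) (rotate k (preorder_word t)))) =
      real (card (cyclic_occs (preorder_word T) (preorder_word t)))"
    by (simp add: cyclic_occs_def sum_of_bool_eq Int_def)
  then show "(\<Sum>k<size M. of_bool (prefix (preorder_word T) (rotate k (preorder_word t)))) =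
      real (fringe_count T t)"
    using fringe_count_eq_cyclic_occs[of T 0 t] by simp
qed

lemma sum_words_starting_with_remainder:
  assumes "lukasiewicz w"
  shows "(\<Sum>u\<in>words_with (mset w + M). of_bool (prefix w u) * F (card (cyclic_occs w u)))
    = (\<Sum>v\<in>words_with M. F (Suc (card (occs w v))) :: real)"
proof -
  have inj: "inj_on ((@) w) (words_with M)" by (auto simp: inj_on_def)
  have img: "{u \<in> words_with (mset w + M). prefix w u} = (@) w ` words_with M"
    by (auto simp: permutations_of_multiset_def prefix_def)
  have "(\<Sum>u\<in>words_with (mset w + M). of_bool (prefix w u) * F (card (cyclic_occs w u)))
      = (\<Sum>u\<in>{u \<in> words_with (mset w + M). prefix w u}. F (card (cyclic_occs w u)))"
    by (intro sum.mono_neutral_cong_right) auto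
  also have "\<dots> = (\<Sum>v\<in>words_with M. F (card (cyclic_occs w (w @ v))))"
    unfolding img sum.reindex[OF inj] by simp
  finally show ?thesis by (simp add: card_cyclic_occs_self_append[OF assms])
qed

abbreviation mean_fringe_count :: "plane_tree \<Rightarrow> nat multiset \<Rightarrow> real" where
  "mean_fringe_count T M \<equiv> average (trees_with M) (\<lambda>t. real (fringe_count T t))"

text \<open>
  Biasing a random tree by its number of copies of \<open>T\<close> amounts to marking a copy. Rotated to the front,
  this copy leaves an arbitrary arrangement of the other letters. This identity describes the
  size-biased distribution of the fringe count that the Stein-Chen method requires.
\<close>

lemma size_biased_fringe_count:
  assumes M: "(\<Sum>x\<in>#M. int x - 1) = -1" and M_eq: "M = mset (preorder_word T) + M'"
  shows "average (trees_with M) (\<lambda>t. real (fringe_count T t) * F (fringe_count T t))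
    = mean_fringe_count T M *
      average (words_with M') (\<lambda>v. F (Suc (card (occs (preorder_word T) v))))"
proof -
  have *: "(\<Sum>t\<in>trees_with M. real (fringe_count T t) * F (fringe_count T t))
      = (\<Sum>v\<in>words_with M'. F (Suc (card (occs (preorder_word T) v))))" for F
    using sum_words_starting_with[OF M, of T F]
      sum_words_starting_with_remainder[where w = "preorder_word T" and M = M' and F = F,
        OF lukasiewicz_preorder_word]
    unfolding M_eq by simp
  have mean: "mean_fringe_count T M = real (card (words_with M')) / real (card (trees_with M))"
    using *[of "\<lambda>_. 1"] by (simp add: average_def)
  show ?thesis
    unfolding mean unfolding average_def *[of F] using card_words_pos[of M'] by simp
qed

lemma mean_fringe_count_eq_0:
  assumes M: "(\<Sum>x\<in>#M. int x - 1) = -1" and "\<not> mset (preorder_word T) \<subseteq># M"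
  shows "mean_fringe_count T M = 0"
proof -
  have "\<not> prefix (preorder_word T) u" if "u \<in> words_with M" for u
    using that assms(2) by (auto simp: permutations_of_multiset_def prefix_def)
  then have "(\<Sum>u\<in>words_with M. of_bool (prefix (preorder_word T) u) * (1 :: real)) = 0"
    by simp
  then show ?thesis
    using sum_words_starting_with[OF M, of T "\<lambda>_. 1"] by (simp add: average_def)
qed

lemma bij_betw_rotate_words: "bij_betw (rotate k) (words_with M) (words_with M)"
proof -
  have "inj_on (rotate k) (words_with M)" by (auto intro: inj_onI dest: rotate_inj)
  moreover have "rotate k ` words_with M \<subseteq> words_with M"
    by (auto simp: permutations_of_multiset_def)
  ultimately show ?thesis by (simp add: bij_betw_def endo_inj_surj)
qed

text \<open>
  A cyclic occurrence in a random word is equally likely to start at each of the \<open>size M\<close> positions,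
  and at most \<open>length w - 1\<close> starting positions make it cross the end of the word.
\<close>

lemma average_cyclic_minus_linear_occs:
  assumes w: "w \<noteq> []" and M: "0 < size M"
  shows "average (words_with M) (\<lambda>u. real (card (cyclic_occs w u)) - real (card (occs w u)))
    \<le> real (length w - 1) / size M * average (words_with M) (\<lambda>u. real (card (cyclic_occs w u)))"
proof -
  let ?n = "size M" and ?m = "length w"
  define s where "s = (\<Sum>u\<in>words_with M. of_bool (prefix w u) :: real)"
  have len: "length u = ?n" if "u \<in> words_with M" for u
    using that by (auto simp: permutations_of_multiset_def)
  have start: "(\<Sum>u\<in>words_with M. of_bool (prefix w (rotate k u))) = s" for k
    unfolding s_def using sum.reindex_bij_betw[OF bij_betw_rotate_words, of "\<lambda>u. of_bool (prefix w u)"] .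
  have cyc: "real (card (cyclic_occs w u)) = (\<Sum>k<?n. of_bool (prefix w (rotate k u)))"
    if "u \<in> words_with M" for u
    using len[OF that] by (simp add: cyclic_occs_def sum_of_bool_eq Int_def)
  have total: "(\<Sum>u\<in>words_with M. real (card (cyclic_occs w u))) = real ?n * s"
  proof -
    have "(\<Sum>u\<in>words_with M. real (card (cyclic_occs w u))) =
        (\<Sum>u\<in>words_with M. \<Sum>k<?n. of_bool (prefix w (rotate k u)))"
      by (intro sum.cong refl cyc)
    also have "\<dots> = (\<Sum>k<?n. s)"
      by (subst sum.swap) (simp only: start)
    finally show ?thesis by simp
  qed
  have wrap: "real (card (cyclic_occs w u)) - real (card (occs w u)) \<le>
      (\<Sum>k\<in>{?n - ?m<..<?n}. of_bool (prefix w (rotate k u)))" if u: "u \<in> words_with M" for u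
  proof -
    let ?W = "{k \<in> {?n - ?m<..<?n}. prefix w (rotate k u)}"
    have "cyclic_occs w u \<subseteq> occs w u \<union> ?W"
    proof
      fix k assume "k \<in> cyclic_occs w u"
      then have k: "k < length u" "prefix w (rotate k u)" by (auto simp: cyclic_occs_def)
      show "k \<in> occs w u \<union> ?W"
      proof (cases "?n - ?m < k")
        case True
        then show ?thesis using k len[OF u] by simp
      next
        case False
        have "prefix w (drop k u @ take k u)" using k by (simp add: rotate_drop_take)
        moreover have "prefix (drop k u) (drop k u @ take k u)" by simp
        moreover have "?m \<le> length (drop k u)"
          using False prefix_length_le[OF k(2)] len[OF u] by simp
        ultimately have "prefix w (drop k u)" by (rule prefix_length_prefix)
        then show ?thesis by (simp add: occs_def)
      qed
    qed
    then have "card (cyclic_occs w u) \<le> card (occs w u \<union> ?W)"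
      using finite_occs[OF w] by (intro card_mono) auto
    also have "\<dots> \<le> card (occs w u) + card ?W" by (rule card_Un_le)
    finally show ?thesis by (simp add: sum_of_bool_eq Int_def)
  qed
  have "(\<Sum>u\<in>words_with M. real (card (cyclic_occs w u)) - real (card (occs w u))) \<le>
      (\<Sum>u\<in>words_with M. \<Sum>k\<in>{?n - ?m<..<?n}. of_bool (prefix w (rotate k u)))"
    by (intro sum_mono wrap)
  also have "\<dots> = (\<Sum>k\<in>{?n - ?m<..<?n}. s)"
    by (subst sum.swap) (simp only: start)
  also have "\<dots> = real (?n - (?n - ?m) - 1) * s" by simp
  also have "\<dots> \<le> real (?m - 1) * s"
    unfolding s_def by (intro mult_right_mono of_nat_mono sum_nonneg) auto
  also have "\<dots> = real (?m - 1) / ?n * (\<Sum>u\<in>words_with M. real (card (cyclic_occs w u)))"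
    using M unfolding nonempty_has_size[symmetric] by (simp add: total)
  finally show ?thesis
    unfolding average_def times_divide_eq_right by (rule divide_right_mono) simp
qed

section \<open>Deleting a letter from a random word\<close>

text \<open>
  Occurrences that are broken when a letter is inserted before position \<open>p\<close>.
\<close>

definition straddling :: "nat list \<Rightarrow> nat list \<Rightarrow> nat \<Rightarrow> nat set" where
  "straddling w u p = {k \<in> occs w u. k < p \<and> p < k + length w}"

text \<open>
  Occurrences that use the letter at position \<open>p\<close>, and hence are lost when it is deleted.
\<close>

definition covering :: "nat list \<Rightarrow> nat list \<Rightarrow> nat \<Rightarrow> nat set" where
  "covering w u p = {k \<in> occs w u. k \<le> p \<and> p < k + length w}"

lemma card_occs_cut:
  assumes "w \<noteq> []"
  shows "card (occs w (a @ b)) =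
    card (occs w a) + card (straddling w (a @ b) (length a)) + card (occs w b)"
proof -
  let ?S = "straddling w (a @ b) (length a)"
  have "k \<in> occs w (a @ b) \<longleftrightarrow> k \<in> occs w a \<union> ?S \<union> (+) (length a) ` occs w b" for k
  proof (cases "k < length a")
    case True
    have "prefix w (drop k a @ b) \<longleftrightarrow> prefix w (drop k a)" if "k + length w \<le> length a"
      using that True by (auto simp: prefix_append)
    then show ?thesis
      using True occs_bound[of k w a] assms
      by (auto simp: straddling_def occs_def)
  next
    case False
    then obtain j where j: "k = length a + j" using False le_Suc_ex[of "length a" k] by auto
    then have "k \<in> occs w (a @ b) \<longleftrightarrow> j \<in> occs w b" "k \<notin> occs w a" "k \<notin> straddling w (a @ b) (length a)"
      using assms by (simp_all add: occs_def straddling_def)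
    moreover have "k \<in> (+) (length a) ` occs w b \<longleftrightarrow> j \<in> occs w b"
      using j by auto
    ultimately show ?thesis by blast
  qed
  then have "occs w (a @ b) = occs w a \<union> ?S \<union> (+) (length a) ` occs w b"
    by blast
  also have "card \<dots> = card (occs w a \<union> ?S) + card ((+) (length a) ` occs w b)"
  proof (rule card_Un_disjoint)
    show "(occs w a \<union> ?S) \<inter> (+) (length a) ` occs w b = {}"
      using assms by (auto simp: straddling_def dest: occs_bound)
  qed (use assms in \<open>auto simp: straddling_def finite_occs\<close>)
  also have "card (occs w a \<union> ?S) = card (occs w a) + card ?S"
  proof (rule card_Un_disjoint)
    show "occs w a \<inter> ?S = {}"
      using assms by (auto simp: straddling_def dest!: occs_bound)
  qed (use assms in \<open>auto simp: straddling_def finite_occs\<close>)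
  finally show ?thesis by (simp add: card_image)
qed

lemma card_occs_cut_letter:
  assumes "w \<noteq> []"
  shows "card (occs w (a @ x # b)) =
    card (occs w a) + card (covering w (a @ x # b) (length a)) + card (occs w b)"
proof -
  let ?u = "a @ x # b"
  have "covering w ?u (length a) =
      straddling w ?u (length a) \<union> (if prefix w (x # b) then {length a} else {})"
  proof (rule set_eqI)
    fix k
    show "k \<in> covering w ?u (length a) \<longleftrightarrow>
        k \<in> straddling w ?u (length a) \<union> (if prefix w (x # b) then {length a} else {})"
      using assms by (cases "k = length a") (auto simp: covering_def straddling_def occs_def)
  qed
  moreover have "card (straddling w ?u (length a) \<union> (if prefix w (x # b) then {length a} else {}))
      = card (straddling w ?u (length a)) + card (if prefix w (x # b) then {length a} else {})"
    using assms by (intro card_Un_disjoint) (auto simp: straddling_def finite_occs)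
  ultimately have "card (covering w ?u (length a)) =
      card (straddling w ?u (length a)) + of_bool (prefix w (x # b))"
    by simp
  then show ?thesis
    using card_occs_cut[OF assms, of a "x # b"] assms by (simp add: card_occs_Cons)
qed

definition insert_at :: "'a \<Rightarrow> nat \<Rightarrow> 'a list \<Rightarrow> 'a list" where
  "insert_at x p v = take p v @ x # drop p v"

text \<open>
  An occurrence that neither is broken by the new letter nor uses it is present both before and after
  the insertion.
\<close>

lemma card_occs_insert_at:
  assumes "w \<noteq> []" "p \<le> length v"
  shows "card (occs w (insert_at x p v)) + card (straddling w v p) =
    card (occs w v) + card (covering w (insert_at x p v) p)"
  using card_occs_cut_letter[OF assms(1), of "take p v" x "drop p v"]
    card_occs_cut[OF assms(1), of "take p v" "drop p v"] assms(2)
  by (simp add: insert_at_def)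

lemma sum_card_straddling:
  assumes "w \<noteq> []"
  shows "(\<Sum>p\<le>length v. card (straddling w v p)) = card (occs w v) * (length w - 1)"
proof -
  have "(\<Sum>p\<le>length v. card (straddling w v p)) =
      (\<Sum>p\<le>length v. \<Sum>k\<in>occs w v. of_bool (k < p \<and> p < k + length w))"
    using finite_occs[OF assms] by (simp add: straddling_def sum_of_bool_eq Int_def)
  also have "\<dots> = (\<Sum>k\<in>occs w v. \<Sum>p\<le>length v. of_bool (k < p \<and> p < k + length w))"
    by (rule sum.swap)
  also have "\<dots> = (\<Sum>k\<in>occs w v. length w - 1)"
  proof (rule sum.cong[OF refl])
    fix k assume "k \<in> occs w v"
    then have "k + length w \<le> length v" using occs_bound assms by blast
    then have "{..length v} \<inter> {p. k < p \<and> p < k + length w} = {k<..<k + length w}" by auto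
    then show "(\<Sum>p\<le>length v. of_bool (k < p \<and> p < k + length w)) = length w - 1"
      by (simp add: sum_of_bool_eq)
  qed
  finally show ?thesis by simp
qed

lemma count_mset_conv_card: "count (mset xs) x = card {j. j < length xs \<and> xs ! j = x}"
  by (simp add: count_mset count_list_eq_length_filter length_filter_conv_card)
    (metis (mono_tags))

lemma sum_card_covering:
  assumes "w \<noteq> []"
  shows "(\<Sum>p | p < length u \<and> u ! p = x. card (covering w u p)) =
    card (occs w u) * count (mset w) x"
proof -
  let ?P = "{p. p < length u \<and> u ! p = x}"
  have "(\<Sum>p\<in>?P. card (covering w u p)) =
      (\<Sum>p\<in>?P. \<Sum>k\<in>occs w u. of_bool (k \<le> p \<and> p < k + length w))"
    using finite_occs[OF assms] by (simp add: covering_def sum_of_bool_eq Int_def)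
  also have "\<dots> = (\<Sum>k\<in>occs w u. \<Sum>p\<in>?P. of_bool (k \<le> p \<and> p < k + length w))"
    by (rule sum.swap)
  also have "\<dots> = (\<Sum>k\<in>occs w u. count (mset w) x)"
  proof (rule sum.cong[OF refl])
    fix k assume k: "k \<in> occs w u"
    then have len: "k + length w \<le> length u" using occs_bound assms by blast
    have nth: "u ! (k + j) = w ! j" if "j < length w" for j
      using k that len by (auto simp: occs_def prefix_def nth_append dest!: arg_cong[of _ _ "\<lambda>l. l ! j"])
    have "?P \<inter> {p. k \<le> p \<and> p < k + length w} = (+) k ` {j. j < length w \<and> w ! j = x}"
    proof (intro equalityI subsetI)
      fix p assume p: "p \<in> ?P \<inter> {p. k \<le> p \<and> p < k + length w}"
      then obtain j where "p = k + j" using le_Suc_ex[of k p] by auto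
      then show "p \<in> (+) k ` {j. j < length w \<and> w ! j = x}" using p nth by auto
    qed (use len nth in auto)
    then show "(\<Sum>p\<in>?P. of_bool (k \<le> p \<and> p < k + length w)) = count (mset w) x"
      by (simp add: sum_of_bool_eq count_mset_conv_card card_image)
  qed
  finally show ?thesis by simp
qed

definition delete_at :: "nat \<Rightarrow> 'a list \<Rightarrow> 'a list" where
  "delete_at p u = take p u @ drop (Suc p) u"

lemma mset_insert_at: "mset (insert_at x p v) = add_mset x (mset v)"
proof -
  have "mset (take p v) + mset (drop p v) = mset v"
    by (metis append_take_drop_id mset_append)
  then show ?thesis by (simp add: insert_at_def)
qed

lemma insert_at_nth: "p \<le> length v \<Longrightarrow> insert_at x p v ! p = x"
  by (simp add: insert_at_def nth_append)

lemma delete_at_insert_at: "p \<le> length v \<Longrightarrow> delete_at p (insert_at x p v) = v"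
  by (simp add: insert_at_def delete_at_def)

lemma insert_at_delete_at: "p < length u \<Longrightarrow> insert_at (u ! p) p (delete_at p u) = u"
  by (simp add: insert_at_def delete_at_def id_take_nth_drop[symmetric])

text \<open>
  The coupling of random words with letters \<open>M\<close> and \<open>M + x\<close>: a pair of a word and an insertion position
  is the same as a longer word with a marked copy of \<open>x\<close>. Every word with letters \<open>M\<close> belongs to
  \<open>size M + 1\<close> pairs and every word with letters \<open>M + x\<close> to as many as there are copies of \<open>x\<close> in \<open>M + x\<close>,
  so uniformly random pairs have uniform marginals.
\<close>

lemma sum_insertions:
  fixes \<phi> :: "nat list \<Rightarrow> nat \<Rightarrow> real"
  shows "(\<Sum>v\<in>words_with M. \<Sum>p\<le>size M. \<phi> (insert_at x p v) p) =
    (\<Sum>u\<in>words_with (add_mset x M). \<Sum>p | p < length u \<and> u ! p = x. \<phi> u p)"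
proof -
  let ?A = "words_with M \<times> {..size M}"
  let ?B = "SIGMA u:words_with (add_mset x M). {p. p < length u \<and> u ! p = x}"
  have del: "mset (delete_at p u) = M" if "mset u = add_mset x M" "p < length u" "u ! p = x" for u p
    using mset_insert_at[of x p "delete_at p u"] insert_at_delete_at[of p u] that by simp
  have "(\<Sum>(v, p)\<in>?A. \<phi> (insert_at x p v) p) = (\<Sum>(u, p)\<in>?B. \<phi> u p)"
  proof (rule sum.reindex_bij_witness[where
        j = "\<lambda>(v, p). (insert_at x p v, p)" and i = "\<lambda>(u, p). (delete_at p u, p)"])
    fix a assume "a \<in> ?A"
    then obtain v p where a: "a = (v, p)" "mset v = M" "p \<le> size M"
      by (auto simp: permutations_of_multiset_def)
    then have p: "p \<le> length v" by auto
    show "(case case a of (v, p) \<Rightarrow> (insert_at x p v, p) of (u, p) \<Rightarrow> (delete_at p u, p)) = a"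
      using a p by (simp add: delete_at_insert_at)
    have "length (insert_at x p v) = Suc (length v)" using p by (simp add: insert_at_def)
    then show "(case a of (v, p) \<Rightarrow> (insert_at x p v, p)) \<in> ?B"
      using a(1,2) p by (simp add: permutations_of_multiset_def mset_insert_at insert_at_nth)
  next
    fix b assume "b \<in> ?B"
    then obtain u p where b: "b = (u, p)" "mset u = add_mset x M" "p < length u" "u ! p = x"
      by (auto simp: permutations_of_multiset_def)
    show "(case case b of (u, p) \<Rightarrow> (delete_at p u, p) of (v, p) \<Rightarrow> (insert_at x p v, p)) = b"
      using b insert_at_delete_at[of p u] by simp
    have "length u = Suc (size M)" using arg_cong[OF b(2), of size] by simp
    then show "(case b of (u, p) \<Rightarrow> (delete_at p u, p)) \<in> ?A"
      using b del by (simp add: permutations_of_multiset_def)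
  qed auto
  then show ?thesis
    by (simp add: sum.cartesian_product sum.Sigma finite_permutations_of_multiset)
qed

lemma sum_insertions_word:
  fixes g :: "nat list \<Rightarrow> real"
  shows "(\<Sum>v\<in>words_with M. \<Sum>p\<le>size M. g (insert_at x p v)) =
    real (count (add_mset x M) x) * (\<Sum>u\<in>words_with (add_mset x M). g u)"
proof -
  have "(\<Sum>v\<in>words_with M. \<Sum>p\<le>size M. g (insert_at x p v)) =
      (\<Sum>u\<in>words_with (add_mset x M). real (card {p. p < length u \<and> u ! p = x}) * g u)"
    by (subst sum_insertions[where \<phi> = "\<lambda>u p. g u"]) simp
  also have "\<dots> = (\<Sum>u\<in>words_with (add_mset x M). real (count (add_mset x M) x) * g u)"
    by (intro sum.cong refl) (simp add: count_mset_conv_card[symmetric] permutations_of_multiset_def)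
  finally show ?thesis by (simp add: sum_distrib_left)
qed

lemma card_insertions:
  fixes M :: "nat multiset"
  shows
  "real (card (words_with M)) * real (Suc (size M)) =
    real (count (add_mset x M) x) * real (card (words_with (add_mset x M)))"
  using sum_insertions_word[of "\<lambda>_. 1" x M] by (simp add: mult.commute)

abbreviation mean_occs :: "nat list \<Rightarrow> nat multiset \<Rightarrow> real" where
  "mean_occs w M \<equiv> average (words_with M) (\<lambda>u. real (card (occs w u)))"

lemma average_insertions:
  fixes M :: "nat multiset"
  shows "average (words_with (add_mset x M)) g =
    average (words_with M) (\<lambda>v. (\<Sum>p\<le>size M. g (insert_at x p v)) / Suc (size M))"
proof -
  let ?c = "real (count (add_mset x M) x)"
  have "average (words_with (add_mset x M)) g =
      (?c * (\<Sum>u\<in>words_with (add_mset x M). g u)) /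
      (?c * real (card (words_with (add_mset x M))))"
    by (simp add: average_def)
  also have "\<dots> = (\<Sum>v\<in>words_with M. \<Sum>p\<le>size M. g (insert_at x p v)) /
      (real (card (words_with M)) * real (Suc (size M)))"
    by (simp only: sum_insertions_word card_insertions[of M x])
  finally show ?thesis
    by (simp add: average_def sum_divide_distrib[symmetric] mult.commute)
qed

lemma average_straddling:
  assumes "w \<noteq> []"
  shows "average (words_with M)
      (\<lambda>v. (\<Sum>p\<le>size M. real (card (straddling w v p))) / Suc (size M))
    = mean_occs w M * (real (length w - 1) / Suc (size M))"
proof -
  have "average (words_with M)
      (\<lambda>v. (\<Sum>p\<le>size M. real (card (straddling w v p))) / Suc (size M))
    = average (words_with M)
      (\<lambda>v. real (length w - 1) / Suc (size M) * real (card (occs w v)))"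
  proof (rule average_cong)
    fix v assume "v \<in> words_with M"
    then have "length v = size M" by (auto simp: permutations_of_multiset_def)
    then have "(\<Sum>p\<le>size M. real (card (straddling w v p))) = real (card (occs w v)) * real (length w - 1)"
      using sum_card_straddling[OF assms, of v] by (simp flip: of_nat_sum of_nat_mult)
    then show "(\<Sum>p\<le>size M. real (card (straddling w v p))) / Suc (size M) =
        real (length w - 1) / Suc (size M) * real (card (occs w v))"
      by simp
  qed
  then show ?thesis unfolding average_cmult by (simp only: mult.commute)
qed

lemma average_covering:
  assumes "w \<noteq> []"
  shows "average (words_with M)
      (\<lambda>v. (\<Sum>p\<le>size M. real (card (covering w (insert_at x p v) p))) / Suc (size M))
    = mean_occs w (add_mset x M) * (real (count (mset w) x) / count (add_mset x M) x)"
proof -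
  let ?W = "words_with M" and ?W' = "words_with (add_mset x M)"
  let ?c = "real (count (add_mset x M) x)"
  have "(\<Sum>v\<in>?W. \<Sum>p\<le>size M. real (card (covering w (insert_at x p v) p)))
      = (\<Sum>u\<in>?W'. \<Sum>p | p < length u \<and> u ! p = x. real (card (covering w u p)))"
    by (rule sum_insertions)
  also have "\<dots> = (\<Sum>u\<in>?W'. real (card (occs w u))) * real (count (mset w) x)"
    using sum_card_covering[OF assms] by (simp add: sum_distrib_right flip: of_nat_sum of_nat_mult)
  finally have "average ?W
      (\<lambda>v. (\<Sum>p\<le>size M. real (card (covering w (insert_at x p v) p))) / Suc (size M))
    = (\<Sum>u\<in>?W'. real (card (occs w u))) * real (count (mset w) x) / (real (card ?W) * Suc (size M))"
    by (simp add: average_def sum_divide_distrib[symmetric] mult.commute)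
  also have "\<dots> = (\<Sum>u\<in>?W'. real (card (occs w u))) * real (count (mset w) x) / (?c * real (card ?W'))"
    by (simp only: card_insertions[of M x])
  finally show ?thesis by (simp add: average_def mult.commute)
qed

text \<open>
  Deleting a random letter creates few new occurrences on average, because the deleted letter rarely sat
  inside one of them. This controls the means along the deletion without an explicit formula for them.
\<close>

lemma mean_occs_remove_letter:
  assumes "w \<noteq> []"
  shows "mean_occs w M * (1 - real (length w - 1) / Suc (size M)) \<le> mean_occs w (add_mset x M)"
proof -
  let ?W = "words_with M" and ?L = "real (Suc (size M))"
  have "mean_occs w M \<le> average ?W (\<lambda>v. (\<Sum>p\<le>size M. real (card (occs w (insert_at x p v)))) / ?L
      + (\<Sum>p\<le>size M. real (card (straddling w v p))) / ?L)"
  proof (rule average_mono)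
    fix v assume v: "v \<in> ?W"
    then have len: "length v = size M" by (auto simp: permutations_of_multiset_def)
    have "?L * real (card (occs w v)) = (\<Sum>p\<le>size M. real (card (occs w v)))" by simp
    also have "\<dots> \<le> (\<Sum>p\<le>size M. real (card (occs w (insert_at x p v))) + real (card (straddling w v p)))"
    proof (rule sum_mono)
      fix p assume "p \<in> {..size M}"
      then have "p \<le> length v" using len by simp
      from card_occs_insert_at[OF assms this, of x]
      show "real (card (occs w v)) \<le>
          real (card (occs w (insert_at x p v))) + real (card (straddling w v p))"
        by linarith
    qed
    finally show "real (card (occs w v)) \<le> (\<Sum>p\<le>size M. real (card (occs w (insert_at x p v)))) / ?L
      + (\<Sum>p\<le>size M. real (card (straddling w v p))) / ?L"
      by (simp add: sum.distrib add_divide_distrib[symmetric] pos_le_divide_eq mult.commute)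
  qed
  also have "\<dots> = mean_occs w (add_mset x M) + mean_occs w M * (real (length w - 1) / ?L)"
    by (simp only: average_add average_straddling[OF assms] average_insertions)
  finally show ?thesis by (simp add: algebra_simps)
qed

text \<open>
  The first summand counts the occurrences lost by deleting a random copy of \<open>x\<close>, the second one those
  gained because the copy stood inside them.
\<close>

lemma average_occs_remove_letter:
  assumes "w \<noteq> []" and lip: "\<And>i j. \<bar>h i - h j\<bar> \<le> K * \<bar>real i - real j\<bar>"
  shows "\<bar>average (words_with (add_mset x M)) (\<lambda>u. h (card (occs w u)))
      - average (words_with M) (\<lambda>v. h (card (occs w v)))\<bar>
    \<le> K * (mean_occs w (add_mset x M) * (real (count (mset w) x) / count (add_mset x M) x)
      + mean_occs w M * (real (length w - 1) / Suc (size M)))"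
proof -
  let ?W = "words_with M" and ?L = "real (Suc (size M))"
  let ?D = "\<lambda>v. (\<Sum>p\<le>size M. h (card (occs w (insert_at x p v)))) / ?L - h (card (occs w v))"
  have K: "0 \<le> K" using lip[of 0 1] by simp
  have "average (words_with (add_mset x M)) (\<lambda>u. h (card (occs w u)))
      - average ?W (\<lambda>v. h (card (occs w v))) = average ?W ?D"
    by (simp only: average_insertions average_diff)
  also have "\<bar>\<dots>\<bar> \<le> average ?W (\<lambda>v. \<bar>?D v\<bar>)" by (rule abs_average_le)
  also have "\<dots> \<le> average ?W (\<lambda>v. K * ((\<Sum>p\<le>size M. real (card (covering w (insert_at x p v) p))) / ?L
      + (\<Sum>p\<le>size M. real (card (straddling w v p))) / ?L))"
  proof (rule average_mono)
    fix v assume v: "v \<in> ?W"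
    then have len: "length v = size M" by (auto simp: permutations_of_multiset_def)
    have "?D v = (\<Sum>p\<le>size M. h (card (occs w (insert_at x p v))) - h (card (occs w v))) / ?L"
      by (simp add: sum_subtractf field_simps)
    also have "\<bar>\<dots>\<bar> \<le> (\<Sum>p\<le>size M. \<bar>h (card (occs w (insert_at x p v))) - h (card (occs w v))\<bar>) / ?L"
      by (simp add: divide_right_mono)
    also have "\<dots> \<le> (\<Sum>p\<le>size M. K * (real (card (covering w (insert_at x p v) p))
        + real (card (straddling w v p)))) / ?L"
    proof (intro divide_right_mono sum_mono)
      fix p assume "p \<in> {..size M}"
      then have "p \<le> length v" using len by simp
      from card_occs_insert_at[OF assms(1) this, of x]
      have "\<bar>real (card (occs w (insert_at x p v))) - real (card (occs w v))\<bar> \<le>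
          real (card (covering w (insert_at x p v) p)) + real (card (straddling w v p))"
        by linarith
      from mult_left_mono[OF this K] lip
      show "\<bar>h (card (occs w (insert_at x p v))) - h (card (occs w v))\<bar> \<le>
          K * (real (card (covering w (insert_at x p v) p)) + real (card (straddling w v p)))"
        by (meson order_trans)
    qed simp
    also have "\<dots> = K * ((\<Sum>p\<le>size M. real (card (covering w (insert_at x p v) p))) / ?L
      + (\<Sum>p\<le>size M. real (card (straddling w v p))) / ?L)"
      by (simp only: sum_distrib_left[symmetric] sum.distrib add_divide_distrib[symmetric] times_divide_eq_right)
    finally show "\<bar>?D v\<bar> \<le> K * ((\<Sum>p\<le>size M. real (card (covering w (insert_at x p v) p))) / ?L
      + (\<Sum>p\<le>size M. real (card (straddling w v p))) / ?L)" .
  qed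
  also have "\<dots> = K * (mean_occs w (add_mset x M) * (real (count (mset w) x) / count (add_mset x M) x)
      + mean_occs w M * (real (length w - 1) / ?L))"
    by (simp only: average_cmult average_add average_straddling[OF assms(1)] average_covering[OF assms(1)])
  finally show ?thesis .
qed

lemma mean_occs_remove_letters:
  assumes "w \<noteq> []" "q = real (length w - 1) / Suc (size M)" "q \<le> 1"
  shows "mean_occs w M * (1 - q) ^ length xs \<le> mean_occs w (mset xs + M)"
proof (induction xs)
  case (Cons x xs)
  let ?N = "mset xs + M"
  have nonneg: "0 \<le> mean_occs w N" for N by (simp add: average_nonneg)
  have "mean_occs w M * (1 - q) ^ length (x # xs) \<le> mean_occs w ?N * (1 - q)"
    using mult_right_mono[OF Cons, of "1 - q"] assms(3) by (simp add: mult_ac)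
  also have "\<dots> \<le> mean_occs w ?N * (1 - real (length w - 1) / Suc (size ?N))"
    using nonneg unfolding assms(2)
    by (intro mult_left_mono diff_left_mono divide_left_mono) auto
  also have "\<dots> \<le> mean_occs w (add_mset x ?N)"
    by (rule mean_occs_remove_letter[OF assms(1)])
  finally show ?case by simp
qed simp

text \<open>
  The letters are deleted from the front of \<open>xs\<close> on, so the intermediate words are arrangements of
  \<open>M\<close> together with a suffix of \<open>xs\<close>; the number \<open>B\<close> bounds their mean numbers of occurrences.
\<close>

lemma average_occs_remove_letters:
  assumes w: "w \<noteq> []" and lip: "\<And>i j. \<bar>h i - h j\<bar> \<le> K * \<bar>real i - real j\<bar>"
    and pos: "\<And>x. x \<in> set xs \<Longrightarrow> 0 < count M x"
    and q: "q = real (length w - 1) / Suc (size M)"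
    and B: "\<And>ys. suffix ys xs \<Longrightarrow> mean_occs w (mset ys + M) \<le> B"
  shows "\<bar>average (words_with (mset xs + M)) (\<lambda>u. h (card (occs w u)))
      - average (words_with M) (\<lambda>v. h (card (occs w v)))\<bar>
    \<le> K * B * (\<Sum>x\<leftarrow>xs. real (count (mset w) x) / count M x + q)"
  using pos B
proof (induction xs)
  case (Cons x xs)
  let ?N = "mset xs + M"
  let ?av = "\<lambda>N. average (words_with N) (\<lambda>u. h (card (occs w u)))"
  have K: "0 \<le> K" using lip[of 0 1] by simp
  have q0: "0 \<le> q" using q by simp
  have nonneg: "0 \<le> mean_occs w N" for N by (simp add: average_nonneg)
  have IH: "\<bar>?av ?N - ?av M\<bar> \<le> K * B * (\<Sum>x\<leftarrow>xs. real (count (mset w) x) / count M x + q)"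
    using Cons.prems by (intro Cons.IH) (auto intro: suffix_ConsI)
  have bds: "mean_occs w (add_mset x ?N) \<le> B" "mean_occs w ?N \<le> B"
    using Cons.prems(2)[of "x # xs"] Cons.prems(2)[of xs] by (simp_all add: suffix_Cons)
  have "\<bar>?av (add_mset x ?N) - ?av ?N\<bar>
    \<le> K * (mean_occs w (add_mset x ?N) * (real (count (mset w) x) / count (add_mset x ?N) x)
      + mean_occs w ?N * (real (length w - 1) / Suc (size ?N)))"
    by (rule average_occs_remove_letter[OF w lip])
  also have "\<dots> \<le> K * (B * (real (count (mset w) x) / count M x) + B * q)"
  proof (intro mult_left_mono[OF _ K] add_mono)
    show "mean_occs w (add_mset x ?N) * (real (count (mset w) x) / count (add_mset x ?N) x)
        \<le> B * (real (count (mset w) x) / count M x)"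
      using bds nonneg[of "add_mset x ?N"] Cons.prems(1)[of x]
      by (intro mult_mono divide_left_mono) auto
    show "mean_occs w ?N * (real (length w - 1) / Suc (size ?N)) \<le> B * q"
      unfolding q using bds nonneg[of ?N]
      by (intro mult_mono divide_left_mono) auto
  qed
  finally show ?case using IH by (simp add: algebra_simps)
qed (use lip[of 0 0] in simp)

section \<open>Deleting the letters of the pattern\<close>

lemma sum_list_eq_sum_count:
  fixes f :: "'a \<Rightarrow> real"
  shows "(\<Sum>x\<leftarrow>xs. f x) = (\<Sum>x\<in>set xs. real (count (mset xs) x) * f x)"
proof -
  have "(\<Sum>x\<leftarrow>xs. f x) = (\<Sum>x\<in>X. real (count (mset xs) x) * f x)"
    if "set xs \<subseteq> X" "finite X" for X
    using that
  proof (induction xs)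
    case (Cons a xs)
    have "(\<Sum>x\<in>X. real (count (mset (a # xs)) x) * f x) =
        (\<Sum>x\<in>X. (if a = x then f x else 0) + real (count (mset xs) x) * f x)"
      by (intro sum.cong) (auto simp: algebra_simps)
    then show ?case using Cons by (simp add: sum.distrib)
  qed simp
  then show ?thesis by simp
qed

text \<open>
  The sum that appears in the bound, for the degrees \<open>L\<close> of the small tree and \<open>M\<close> of the large one.
\<close>

definition relative_usage :: "nat multiset \<Rightarrow> nat multiset \<Rightarrow> real" where
  "relative_usage L M = (\<Sum>i\<in>set_mset L. (real (count L i))\<^sup>2 / real (count M i))"

text \<open>
  The Cauchy-Schwarz inequality, applied to the summands
  \<open>count L i = (count L i / sqrt (count M i)) * sqrt (count M i)\<close>.
\<close>

lemma relative_usage_ge_size: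
  assumes "L \<subseteq># M"
  shows "(real (size L))\<^sup>2 \<le> relative_usage L M * real (size M)"
proof -
  have pos: "0 < count M i" if "i \<in># L" for i
    using mset_subset_eqD[OF assms that] by simp
  have "(real (size L))\<^sup>2 =
      (\<Sum>i\<in>set_mset L. (real (count L i) / sqrt (count M i)) * sqrt (count M i))\<^sup>2"
    using pos by (simp add: size_multiset_overloaded_eq)
  also have "\<dots> \<le> (\<Sum>i\<in>set_mset L. (real (count L i) / sqrt (count M i))\<^sup>2) *
      (\<Sum>i\<in>set_mset L. (sqrt (count M i))\<^sup>2)"
    by (rule Cauchy_Schwarz_ineq_sum)
  also have "\<dots> = relative_usage L M * real (\<Sum>i\<in>set_mset L. count M i)"
    by (simp add: relative_usage_def power_divide)
  also have "\<dots> \<le> relative_usage L M * real (size M)"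
  proof (intro mult_left_mono of_nat_mono)
    show "(\<Sum>i\<in>set_mset L. count M i) \<le> size M"
      unfolding size_multiset_overloaded_eq
      using assms by (intro sum_mono2) (auto dest: mset_subset_eqD)
    show "0 \<le> relative_usage L M" unfolding relative_usage_def by (intro sum_nonneg) auto
  qed
  finally show ?thesis .
qed

text \<open>
  If the relative usage is small, the letters of \<open>w\<close> are a small part of the copies of each letter in
  \<open>M\<close>, and the length of \<open>w\<close> is at most of the order of the square root of \<open>size M\<close>. Then the denominators
  and the mean numbers of occurrences change only by bounded factors in the course of the deletion.
\<close>

lemma average_occs_remove_pattern:
  assumes w: "w \<noteq> []" and lip: "\<And>i j. \<bar>h i - h j\<bar> \<le> K * \<bar>real i - real j\<bar>"
    and M: "M = mset w + M'" and S: "relative_usage (mset w) M \<le> 1 / 4"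
  shows "\<bar>average (words_with M) (\<lambda>u. h (card (occs w u)))
      - average (words_with M') (\<lambda>v. h (card (occs w v)))\<bar>
    \<le> K * mean_occs w M * (6 * relative_usage (mset w) M)"
proof -
  let ?S = "relative_usage (mset w) M" and ?m = "length w" and ?n = "size M"
  define q where "q = real (?m - 1) / Suc (size M')"
  have K: "0 \<le> K" using lip[of 0 1] by simp
  have S0: "0 \<le> ?S" unfolding relative_usage_def by (intro sum_nonneg) auto
  have n: "?n = ?m + size M'" using M by simp
  have m: "1 \<le> ?m" using w by (cases w) auto
  have mn: "(real ?m)\<^sup>2 \<le> ?S * real ?n"
    using relative_usage_ge_size[of "mset w" M] M by simp
  have "real ?m * 1 \<le> real ?m * real ?m" using m by (intro mult_left_mono) auto
  also have "\<dots> \<le> 1 / 4 * real ?n"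
    using mn mult_right_mono[OF S, of "real ?n"] by (simp add: power2_eq_square)
  finally have m4: "4 * real ?m \<le> real ?n" by simp
  then have M'_large: "3 / 4 * real ?n \<le> Suc (size M')" using n by simp
  have n0: "0 < real ?n" using n m by simp
  have mq: "real ?m * q \<le> 4 / 3 * ?S"
  proof -
    have "real ?m * q \<le> (real ?m)\<^sup>2 / Suc (size M')"
      unfolding q_def times_divide_eq_right power2_eq_square
      by (intro divide_right_mono mult_left_mono) auto
    also have "\<dots> \<le> (?S * real ?n) / (3 / 4 * real ?n)"
      using mn M'_large n0 S0 by (intro frac_le) auto
    also have "\<dots> = 4 / 3 * ?S"
    proof -
      have "c * x / (3 / 4 * x) = 4 / 3 * c" if "0 < x" for c x :: real using that by simp
      from this[OF n0] show ?thesis .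
    qed
    finally show ?thesis .
  qed
  have q0: "0 \<le> q" by (simp add: q_def)
  have q1: "q \<le> 1"
    using mult_right_mono[of 1 "real ?m" q] m q0 mq S by linarith
  have nonneg: "0 \<le> mean_occs w N" for N by (simp add: average_nonneg)
  \<comment> \<open>A single summand of the relative usage is at most 1/4, and \<open>c \<le> c\<^sup>2\<close> for a count \<open>c \<ge> 1\<close>.\<close>
  have x4: "4 * real (count (mset w) x) \<le> real (count M x)" if "x \<in> set w" for x
  proof -
    have c: "1 \<le> real (count (mset w) x)" using that by (simp add: Suc_le_eq)
    have "0 < real (count M x)" using c unfolding M count_union of_nat_add by linarith
    have "(real (count (mset w) x))\<^sup>2 / real (count M x) \<le> ?S"
      unfolding relative_usage_def using that by (intro member_le_sum) auto
    then have "(real (count (mset w) x))\<^sup>2 / real (count M x) \<le> 1 / 4" using S by linarith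
    then have "4 * (real (count (mset w) x))\<^sup>2 \<le> real (count M x)"
      using \<open>0 < real (count M x)\<close> by (simp add: field_simps)
    moreover have "real (count (mset w) x) * 1 \<le> (real (count (mset w) x))\<^sup>2"
      unfolding power2_eq_square using c by (intro mult_left_mono) auto
    ultimately show ?thesis by linarith
  qed
  have count_M': "3 / 4 * real (count M x) \<le> real (count M' x)" "0 < count M' x" if "x \<in> set w" for x
  proof -
    have "0 < real (count (mset w) x)" using that by simp
    then have "0 < real (count M' x)" "3 / 4 * real (count M x) \<le> real (count M' x)"
      using x4[OF that] unfolding M count_union of_nat_add distrib_left by linarith+
    then show "3 / 4 * real (count M x) \<le> real (count M' x)" "0 < count M' x"
      unfolding of_nat_0_less_iff by blast+
  qed
  \<comment> \<open>Each deletion raises the mean by a factor of at most \<open>1 / (1 - q)\<close>, and \<open>length w * q \<le> 1/3\<close>.\<close>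
  have B: "mean_occs w (mset ys + M') \<le> 2 * mean_occs w M" if ys: "suffix ys w" for ys
  proof -
    obtain zs where zs: "w = zs @ ys" using ys by (rule suffixE)
    let ?N = "mset ys + M'"
    define q' where "q' = real (?m - 1) / Suc (size ?N)"
    have q': "0 \<le> q'" "q' \<le> q"
      unfolding q'_def q_def by (auto intro!: divide_left_mono)
    have "real (length zs) * q' \<le> real ?m * q"
      using q' by (intro mult_mono) (auto simp: zs)
    then have "1 / 2 \<le> 1 + real (length zs) * (- q')" using mq S by simp
    also have "\<dots> \<le> (1 + - q') ^ length zs"
      using q' q1 by (intro Bernoulli_inequality) simp
    finally have "mean_occs w ?N * (1 / 2) \<le> mean_occs w ?N * (1 - q') ^ length zs"
      using nonneg[of ?N] by (intro mult_left_mono) auto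
    also have "\<dots> \<le> mean_occs w (mset zs + ?N)"
      by (rule mean_occs_remove_letters[OF w q'_def]) (use q' q1 in linarith)
    also have "mset zs + ?N = M" using M zs by simp
    finally show ?thesis by simp
  qed
  have "\<bar>average (words_with M) (\<lambda>u. h (card (occs w u)))
      - average (words_with M') (\<lambda>v. h (card (occs w v)))\<bar>
    \<le> K * (2 * mean_occs w M) * (\<Sum>x\<leftarrow>w. real (count (mset w) x) / count M' x + q)"
    using average_occs_remove_letters[OF w lip _ q_def, where xs = w] count_M'(2) B
    unfolding M by blast
  also have "\<dots> \<le> K * (2 * mean_occs w M) * (8 / 3 * ?S)"
  proof (intro mult_left_mono)
    have "(\<Sum>x\<leftarrow>w. real (count (mset w) x) / count M' x) =
        (\<Sum>x\<in>set w. (real (count (mset w) x))\<^sup>2 / count M' x)"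
      by (simp add: sum_list_eq_sum_count power2_eq_square)
    also have "\<dots> \<le> (\<Sum>x\<in>set w. 4 / 3 * ((real (count (mset w) x))\<^sup>2 / count M x))"
    proof (rule sum_mono)
      fix x assume x: "x \<in> set w"
      have "0 < real (count M x)" using x unfolding M by (simp add: add_pos_nonneg)
      then have "(real (count (mset w) x))\<^sup>2 / count M' x \<le>
          (real (count (mset w) x))\<^sup>2 / (3 / 4 * real (count M x))"
        using count_M'[OF x] by (intro divide_left_mono) auto
      then show "(real (count (mset w) x))\<^sup>2 / count M' x \<le>
          4 / 3 * ((real (count (mset w) x))\<^sup>2 / count M x)" by simp
    qed
    also have "\<dots> = 4 / 3 * ?S" by (simp add: relative_usage_def sum_distrib_left)
    finally show "(\<Sum>x\<leftarrow>w. real (count (mset w) x) / count M' x + q) \<le> 8 / 3 * ?S"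
      using mq by (simp add: sum_list_addf sum_list_triv)
  qed (use K nonneg in auto)
  also have "\<dots> \<le> K * mean_occs w M * (6 * ?S)"
  proof -
    have "0 \<le> K * mean_occs w M" using K nonneg by simp
    from mult_left_mono[OF _ this, of "2 * (8 / 3 * ?S)" "6 * ?S"] S0
    show ?thesis by (simp add: mult_ac)
  qed
  finally show ?thesis .
qed

section \<open>The Stein equation of the Poisson distribution\<close>

lemma pmf_poisson_Suc:
  assumes "0 < r"
  shows "real (Suc j) * pmf (poisson_pmf r) (Suc j) = r * pmf (poisson_pmf r) j"
proof -
  have "pmf (poisson_pmf r) (Suc j) = r / Suc j * pmf (poisson_pmf r) j"
    using assms by (simp add: divide_simps)
  then show ?thesis by simp
qed

lemma pmf_poisson_sums:
  assumes "0 < r"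
  shows "pmf (poisson_pmf r) sums 1"
proof -
  have "(\<lambda>j. r ^ j /\<^sub>R fact j * exp (- r)) sums (exp r * exp (- r))"
    by (intro sums_mult2 exp_converges)
  moreover have "pmf (poisson_pmf r) = (\<lambda>j. r ^ j /\<^sub>R fact j * exp (- r))"
    using assms by (intro ext) (simp add: field_simps)
  ultimately show ?thesis by (simp add: exp_minus del: pmf_poisson)
qed

text \<open>
  Equivalently, \<open>P {..j} / p j\<close> increases with \<open>j\<close>: the ratio \<open>p (i + 1) / p i = r / (i + 1)\<close> is at least
  \<open>r / (j + 1)\<close> for \<open>i \<le> j\<close>.
\<close>

lemma poisson_head_growth:
  assumes "0 < r"
  shows "r * measure_pmf.prob (poisson_pmf r) {..j} \<le>
    real (Suc j) * measure_pmf.prob (poisson_pmf r) {..Suc j}"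
proof -
  let ?p = "pmf (poisson_pmf r)"
  have "r * (\<Sum>i\<le>j. ?p i) = (\<Sum>i\<le>j. real (Suc i) * ?p (Suc i))"
    by (simp only: pmf_poisson_Suc[OF assms] sum_distrib_left)
  also have "\<dots> \<le> (\<Sum>i\<le>j. real (Suc j) * ?p (Suc i))"
    by (intro sum_mono mult_right_mono) auto
  also have "\<dots> \<le> real (Suc j) * (\<Sum>i\<le>Suc j. ?p i)"
    unfolding sum_distrib_left[symmetric] sum.atMost_Suc_shift
    by (intro mult_left_mono) auto
  finally show ?thesis by (simp add: measure_measure_pmf_finite del: sum.atMost_Suc)
qed

text \<open>
  Equivalently, \<open>P {j<..} / p j\<close> decreases with \<open>j\<close>, because the ratios of successive weights beyond \<open>j\<close>
  are at most \<open>r / (j + 1)\<close>.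
\<close>

lemma poisson_tail_growth:
  assumes "0 < r"
  shows "real (Suc j) * (1 - measure_pmf.prob (poisson_pmf r) {..Suc j}) \<le>
    r * (1 - measure_pmf.prob (poisson_pmf r) {..j})"
proof -
  let ?p = "pmf (poisson_pmf r)"
  have tail: "(\<lambda>i. ?p (i + Suc k)) sums (1 - measure_pmf.prob (poisson_pmf r) {..k})" for k
    using sums_split_initial_segment[OF pmf_poisson_sums[OF assms], of "Suc k"]
    by (simp add: measure_measure_pmf_finite lessThan_Suc_atMost del: sum.lessThan_Suc)
  have "real (Suc j) * ?p (i + Suc (Suc j)) \<le> r * ?p (i + Suc j)" for i
  proof -
    have "real (Suc j) * ?p (i + Suc (Suc j)) \<le> real (Suc (i + Suc j)) * ?p (Suc (i + Suc j))"
      by (intro mult_mono) auto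
    then show ?thesis by (simp only: pmf_poisson_Suc[OF assms])
  qed
  from sums_le[OF this sums_mult[OF tail] sums_mult[OF tail]] show ?thesis .
qed

text \<open>
  The value at \<open>j + 1\<close> of the usual solution of the Stein equation; the shift keeps to the arguments on
  which the equation determines that solution.
\<close>

definition stein_solution :: "real \<Rightarrow> nat set \<Rightarrow> nat \<Rightarrow> real" where
  "stein_solution r A j = (measure_pmf.prob (poisson_pmf r) (A \<inter> {..j})
      - measure_pmf.prob (poisson_pmf r) A * measure_pmf.prob (poisson_pmf r) {..j})
    / (r * pmf (poisson_pmf r) j)"

lemma prob_atMost_Suc:
  "measure_pmf.prob (p :: nat pmf) (A \<inter> {..Suc j}) =
    measure_pmf.prob p (A \<inter> {..j}) + indicator A (Suc j) * pmf p (Suc j)"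
proof (cases "Suc j \<in> A")
  case True
  then have "A \<inter> {..Suc j} = insert (Suc j) (A \<inter> {..j})" by auto
  then show ?thesis using True
    by (simp add: measure_measure_pmf_finite)
next
  case False
  then have "A \<inter> {..Suc j} = A \<inter> {..j}" by (auto simp: le_Suc_eq)
  then show ?thesis using False by simp
qed

text \<open>
  For \<open>j = 0\<close> the truncated difference \<open>j - 1\<close> is harmless, since its term has the factor 0.
\<close>

lemma stein_equation:
  assumes "0 < r"
  shows "r * stein_solution r A j - real j * stein_solution r A (j - 1) =
    indicator A j - measure_pmf.prob (poisson_pmf r) A"
proof (cases j)
  case 0
  have "A \<inter> {..0} = (if 0 \<in> A then {0} else {})" by auto
  moreover have "{..0 :: nat} = {0}" by auto
  ultimately show ?thesis using assms 0
    by (simp add: stein_solution_def measure_pmf_single field_simps)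
next
  case (Suc i)
  let ?P = "measure_pmf.prob (poisson_pmf r)" and ?p = "pmf (poisson_pmf r)"
  let ?N = "\<lambda>k. ?P (A \<inter> {..k}) - ?P A * ?P {..k}"
  have pos: "0 < ?p i" "0 < ?p (Suc i)" using assms by simp_all
  have "r * stein_solution r A (Suc i) = ?N (Suc i) / ?p (Suc i)"
    using assms pos by (simp add: stein_solution_def del: pmf_poisson)
  moreover have "real (Suc i) * stein_solution r A i = ?N i / ?p (Suc i)"
  proof -
    have "real (Suc i) * stein_solution r A i = real (Suc i) * ?N i / (real (Suc i) * ?p (Suc i))"
      by (simp only: stein_solution_def pmf_poisson_Suc[OF assms] times_divide_eq_right)
    then show ?thesis by (simp del: of_nat_Suc pmf_poisson)
  qed
  moreover have "?N (Suc i) = ?N i + (indicator A (Suc i) - ?P A) * ?p (Suc i)"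
    using prob_atMost_Suc[of "poisson_pmf r" A i] prob_atMost_Suc[of "poisson_pmf r" UNIV i]
    by (simp add: algebra_simps del: pmf_poisson)
  ultimately have "r * stein_solution r A (Suc i) - real (Suc i) * stein_solution r A i =
      (?N i + (indicator A (Suc i) - ?P A) * ?p (Suc i)) / ?p (Suc i) - ?N i / ?p (Suc i)"
    by simp
  also have "\<dots> = indicator A (Suc i) - ?P A"
    using pos by (simp add: add_divide_distrib del: pmf_poisson)
  finally show ?thesis using Suc by simp
qed

text \<open>
  The increment is linear in the weights that \<open>A\<close> receives below, at and above \<open>Suc j\<close>. By the growth of
  heads and tails its coefficients are nonpositive, nonnegative and nonpositive. It is therefore largest
  when \<open>A\<close> is the single point \<open>Suc j\<close>, and smallest for the complement of that point, for which it is
  the negative of the largest value because \<open>A = UNIV\<close> gives the solution 0.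
\<close>

lemma stein_step:
  assumes r: "0 < r"
  shows "\<bar>stein_solution r A (Suc j) - stein_solution r A j\<bar> \<le> 1 / r"
proof -
  let ?P = "measure_pmf.prob (poisson_pmf r)" and ?p = "pmf (poisson_pmf r)"
  define s t where "s = ?p j" and "t = ?p (Suc j)"
  have st: "0 < s" "0 < t" "real (Suc j) * t = r * s"
    unfolding s_def t_def using r pmf_poisson_Suc[OF r] by simp_all
  define a0 c0 where "a0 = ?P {..j}" and "c0 = 1 - ?P {..Suc j}"
  have sum1: "a0 + t + c0 = 1"
    using prob_atMost_Suc[of "poisson_pmf r" UNIV j] by (simp add: a0_def c0_def t_def del: pmf_poisson)
  define a d c where "a = ?P (A \<inter> {..j})" and "d = indicator A (Suc j) * t"
    and "c = ?P A - ?P (A \<inter> {..Suc j})"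
  have PA: "?P A = a + d + c"
    using prob_atMost_Suc[of "poisson_pmf r" A j] by (simp add: a_def d_def c_def t_def del: pmf_poisson)
  have c_eq: "c = ?P (A - {..Suc j})"
    unfolding c_def by (subst measure_pmf.finite_measure_Diff'[symmetric]) auto
  have c0_eq: "c0 = ?P (UNIV - {..Suc j})"
    unfolding c0_def by (subst measure_pmf.prob_compl[symmetric]) auto
  have rng: "0 \<le> a" "a \<le> a0" "0 \<le> d" "d \<le> t" "0 \<le> c" "c \<le> c0"
    using st(2) unfolding a_def a0_def d_def c_eq c0_eq
    by (auto intro!: measure_pmf.finite_measure_mono simp: indicator_def)
  \<comment> \<open>The coefficients of the weights of \<open>A\<close> below, at and above \<open>Suc j\<close>.\<close>
  define \<alpha> \<beta> \<gamma> where "\<alpha> = c0 / (r * t) - (t + c0) / (r * s)"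
    and "\<beta> = c0 / (r * t) + a0 / (r * s)" and "\<gamma> = a0 / (r * s) - (a0 + t) / (r * t)"
  have "stein_solution r A (Suc j) = (a + d - (a + d + c) * (a0 + t)) / (r * t)"
    unfolding stein_solution_def PA prob_atMost_Suc
    using prob_atMost_Suc[of "poisson_pmf r" UNIV j]
    by (simp add: a_def d_def a0_def t_def del: pmf_poisson)
  also have "a + d - (a + d + c) * (a0 + t) = (a + d) * c0 - c * (a0 + t)"
  proof -
    have "c0 = 1 - a0 - t" using sum1 by simp
    show ?thesis unfolding \<open>c0 = 1 - a0 - t\<close> by (simp add: algebra_simps)
  qed
  finally have S: "stein_solution r A (Suc j) = ((a + d) * c0 - c * (a0 + t)) / (r * t)" .
  have "stein_solution r A j = (a - (a + d + c) * a0) / (r * s)"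
    unfolding stein_solution_def PA by (simp add: a_def a0_def s_def del: pmf_poisson)
  also have "a - (a + d + c) * a0 = a * (t + c0) - (d + c) * a0"
  proof -
    have "t + c0 = 1 - a0" using sum1 by simp
    show ?thesis unfolding \<open>t + c0 = 1 - a0\<close> by (simp add: algebra_simps)
  qed
  finally have S': "stein_solution r A j = (a * (t + c0) - (d + c) * a0) / (r * s)" .
  have diff: "stein_solution r A (Suc j) - stein_solution r A j = a * \<alpha> + d * \<beta> + c * \<gamma>"
    unfolding S S' \<alpha>_def \<beta>_def \<gamma>_def using st r by (simp add: field_simps)
  \<comment> \<open>The case \<open>A = UNIV\<close>.\<close>
  have zero: "a0 * \<alpha> + t * \<beta> + c0 * \<gamma> = 0"
    unfolding \<alpha>_def \<beta>_def \<gamma>_def using st r by (simp add: field_simps)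
  have head: "r * a0 \<le> real (Suc j) * (a0 + t)"
    using poisson_head_growth[OF r, of j] prob_atMost_Suc[of "poisson_pmf r" UNIV j]
    by (simp add: a0_def t_def del: pmf_poisson)
  have tail: "real (Suc j) * c0 \<le> r * (t + c0)"
  proof -
    have "t + c0 = 1 - a0" using sum1 by simp
    then show ?thesis using poisson_tail_growth[OF r, of j] by (simp only: a0_def c0_def)
  qed
  have "r * (c0 * s) = (r * s) * c0" by (simp only: mult_ac)
  also have "\<dots> = real (Suc j) * c0 * t" unfolding st(3)[symmetric] by (simp only: mult_ac)
  also have "\<dots> \<le> r * ((t + c0) * t)"
    using mult_right_mono[OF tail, of t] st(2) by (simp add: algebra_simps)
  finally have "c0 * s \<le> (t + c0) * t" using r by simp
  then have "\<alpha> \<le> 0"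
    unfolding \<alpha>_def using st r by (simp add: field_simps)
  moreover have "r * (a0 * t) \<le> r * ((a0 + t) * s)"
  proof -
    have "r * (a0 * t) \<le> real (Suc j) * (a0 + t) * t"
      using mult_right_mono[OF head, of t] st(2) by (simp add: algebra_simps)
    also have "\<dots> = (real (Suc j) * t) * (a0 + t)" by (simp only: mult_ac)
    also have "\<dots> = r * ((a0 + t) * s)" unfolding st(3) by (simp only: mult_ac)
    finally show ?thesis .
  qed
  then have "a0 * t \<le> (a0 + t) * s" using r by simp
  then have "\<gamma> \<le> 0"
    unfolding \<gamma>_def using st r by (simp add: field_simps)
  moreover have "0 \<le> \<beta>"
    unfolding \<beta>_def using rng st r by (intro add_nonneg_nonneg divide_nonneg_nonneg) auto
  ultimately have "a * \<alpha> \<le> 0" "a0 * \<alpha> \<le> a * \<alpha>" "0 \<le> d * \<beta>" "d * \<beta> \<le> t * \<beta>"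
      "c * \<gamma> \<le> 0" "c0 * \<gamma> \<le> c * \<gamma>"
    using rng by (auto simp: mult_nonneg_nonpos mult_right_mono mult_right_mono_neg)
  then have "\<bar>stein_solution r A (Suc j) - stein_solution r A j\<bar> \<le> t * \<beta>"
    using diff zero by linarith
  also have "t * \<beta> = c0 / r + a0 / real (Suc j)"
    unfolding \<beta>_def st(3)[symmetric] distrib_left using st(2) by (simp del: of_nat_Suc)
  also have "\<dots> \<le> c0 / r + (a0 + t) / r"
  proof -
    have "a0 / real (Suc j) \<le> (a0 + t) / r"
      using head r by (simp add: divide_le_eq pos_le_divide_eq mult.commute del: of_nat_Suc)
    then show ?thesis by simp
  qed
  also have "\<dots> = 1 / r"
    using sum1 by (simp add: add_divide_distrib[symmetric])
  finally show ?thesis .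
qed

lemma stein_Lipschitz:
  assumes "0 < r"
  shows "\<bar>stein_solution r A i - stein_solution r A j\<bar> \<le> 1 / r * \<bar>real i - real j\<bar>"
proof -
  have up: "\<bar>stein_solution r A (k + d) - stein_solution r A k\<bar> \<le> 1 / r * real d" for k d
  proof (induction d)
    case (Suc d)
    then show ?case using stein_step[OF assms, of A "k + d"]
      by (simp add: add_divide_distrib)
  qed simp
  show ?thesis
  proof (cases "i \<le> j")
    case True
    then show ?thesis using up[of i "j - i"] by (simp add: abs_minus_commute of_nat_diff)
  next
    case False
    then show ?thesis using up[of j "i - j"] by (simp add: of_nat_diff)
  qed
qed

section \<open>Poisson approximation\<close>

text \<open>
  The Stein equation turns the error into \<open>r\<close> times the difference between the averages of one Lipschitz
  function of the cyclic count and of the count after the pattern is removed; the linear count in the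
  unreduced words is the intermediate term.
\<close>

lemma stein_error_fringe_count:
  assumes M: "(\<Sum>x\<in>#M. int x - 1) = -1" and pos: "0 < mean_fringe_count T M"
    and S: "relative_usage (mset (preorder_word T)) M \<le> 1 / 4"
  shows "\<bar>average (trees_with M) (\<lambda>t. indicator A (fringe_count T t))
      - measure_pmf.prob (poisson_pmf (mean_fringe_count T M)) A\<bar>
    \<le> 7 * mean_fringe_count T M * relative_usage (mset (preorder_word T)) M"
proof -
  let ?w = "preorder_word T" and ?N = "fringe_count T"
  define r where "r = mean_fringe_count T M"
  let ?S = "relative_usage (mset ?w) M"
  define h where "h = stein_solution r A"
  have r: "0 < r" using pos by (simp add: r_def)
  have S0: "0 \<le> ?S" unfolding relative_usage_def by (intro sum_nonneg) auto
  have lip: "\<bar>h i - h j\<bar> \<le> 1 / r * \<bar>real i - real j\<bar>" for i j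
    unfolding h_def by (rule stein_Lipschitz[OF r])
  have sub: "mset ?w \<subseteq># M" using mean_fringe_count_eq_0[OF M] pos by fastforce
  define M' where "M' = M - mset ?w"
  have M_eq: "M = mset ?w + M'" using sub by (simp add: M'_def)
  have n: "0 < size M" by (rule size_pos_if_excess[OF M])
  have m: "1 \<le> length ?w" by (cases ?w) auto
  let ?cyc = "average (words_with M) (\<lambda>u. h (card (cyclic_occs ?w u)))"
  let ?lin = "average (words_with M) (\<lambda>u. h (card (occs ?w u)))"
  let ?rem = "average (words_with M') (\<lambda>v. h (card (occs ?w v)))"
  have trees: "average (words_with M) (\<lambda>u. f (card (cyclic_occs ?w u))) =
      average (trees_with M) (\<lambda>t. f (?N t))" for f
    by (rule average_words_eq_average_trees[OF M]) (simp add: fringe_count_eq_cyclic_occs)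
  have "average (trees_with M) (\<lambda>t. indicator A (?N t)) - measure_pmf.prob (poisson_pmf r) A
      = average (trees_with M) (\<lambda>t. indicator A (?N t) - measure_pmf.prob (poisson_pmf r) A)"
    using finite_trees_with[OF M] by (simp add: average_diff average_const)
  also have "\<dots> = average (trees_with M) (\<lambda>t. r * h (?N t) - real (?N t) * h (?N t - 1))"
    by (simp only: h_def stein_equation[OF r])
  also have "\<dots> = r * ?cyc - r * ?rem"
    using size_biased_fringe_count[OF M M_eq, of "\<lambda>j. h (j - 1)"]
    by (simp add: average_diff average_cmult trees r_def)
  finally have "\<bar>average (trees_with M) (\<lambda>t. indicator A (?N t)) - measure_pmf.prob (poisson_pmf r) A\<bar>
      = r * \<bar>?cyc - ?rem\<bar>"
    using r by (simp add: right_diff_distrib[symmetric] abs_mult)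
  also have "\<dots> \<le> r * (\<bar>?cyc - ?lin\<bar> + \<bar>?lin - ?rem\<bar>)"
    using r by (intro mult_left_mono) auto
  also have "\<bar>?cyc - ?lin\<bar> \<le> ?S"
  proof -
    have "\<bar>?cyc - ?lin\<bar> \<le> average (words_with M)
        (\<lambda>u. \<bar>h (card (cyclic_occs ?w u)) - h (card (occs ?w u))\<bar>)"
      unfolding average_diff[symmetric] by (rule abs_average_le)
    also have "\<dots> \<le> average (words_with M)
        (\<lambda>u. 1 / r * (real (card (cyclic_occs ?w u)) - real (card (occs ?w u))))"
    proof (rule average_mono)
      fix u
      have "card (occs ?w u) \<le> card (cyclic_occs ?w u)"
        by (intro card_mono finite_cyclic_occs occs_subset_cyclic_occs) simp
      then show "\<bar>h (card (cyclic_occs ?w u)) - h (card (occs ?w u))\<bar> \<le>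
          1 / r * (real (card (cyclic_occs ?w u)) - real (card (occs ?w u)))"
        using lip[of "card (cyclic_occs ?w u)" "card (occs ?w u)"] by simp
    qed
    also have "\<dots> \<le> 1 / r * (real (length ?w - 1) / size M * r)"
      unfolding average_cmult
      using average_cyclic_minus_linear_occs[of ?w M] n r trees[of real]
      by (intro mult_left_mono) (auto simp: r_def)
    also have "\<dots> = real (length ?w - 1) / size M" using r by simp
    also have "\<dots> \<le> (real (length ?w))\<^sup>2 / size M"
    proof (intro divide_right_mono)
      have "real (length ?w) * 1 \<le> real (length ?w) * real (length ?w)"
        using m by (intro mult_left_mono) auto
      moreover have "real (length ?w - 1) \<le> real (length ?w)" by simp
      ultimately show "real (length ?w - 1) \<le> (real (length ?w))\<^sup>2"
        unfolding power2_eq_square by linarith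
    qed simp
    also have "\<dots> \<le> ?S"
      using relative_usage_ge_size[OF sub] n by (simp add: pos_divide_le_eq)
    finally show ?thesis .
  qed
  also have "\<bar>?lin - ?rem\<bar> \<le> 6 * ?S"
  proof -
    have "mean_occs ?w M \<le> average (words_with M) (\<lambda>u. real (card (cyclic_occs ?w u)))"
      by (intro average_mono of_nat_mono card_mono finite_cyclic_occs occs_subset_cyclic_occs) simp
    then have le: "mean_occs ?w M \<le> r" using trees[of real] by (simp add: r_def)
    have "\<bar>?lin - ?rem\<bar> \<le> 1 / r * mean_occs ?w M * (6 * ?S)"
      by (rule average_occs_remove_pattern[OF _ lip M_eq S]) simp
    also have "\<dots> \<le> 1 / r * r * (6 * ?S)"
      using le r S0 by (intro mult_right_mono mult_left_mono) auto
    finally show ?thesis using r by simp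
  qed
  finally show ?thesis using r by (simp add: r_def algebra_simps)
qed

text \<open>
  The mass outside 0 is \<open>1 - exp (- r)\<close>.
\<close>

lemma Po_close_to_0:
  assumes "0 \<le> r"
  shows "\<bar>measure_pmf.prob (Po r) A - indicator A 0\<bar> \<le> r"
proof (cases "r = 0")
  case True
  then show ?thesis by (simp add: Po_def indicator_def)
next
  case False
  then have r: "0 < r" using assms by simp
  let ?P = "measure_pmf.prob (poisson_pmf r)"
  have p0: "?P {0} = exp (- r)" using r by (simp add: measure_pmf_single)
  have e: "1 - r \<le> exp (- r)" using exp_ge_add_one_self[of "- r"] by simp
  have "\<bar>?P A - indicator A 0\<bar> \<le> r"
  proof (cases "0 \<in> A")
    case True
    then have "?P {0} \<le> ?P A" by (intro measure_pmf.finite_measure_mono) auto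
    then show ?thesis using True p0 e measure_pmf.prob_le_1[of "poisson_pmf r" A] by simp
  next
    case False
    then have "?P A \<le> ?P (UNIV - {0})" by (intro measure_pmf.finite_measure_mono) auto
    also have "\<dots> = 1 - ?P {0}" using measure_pmf.prob_compl[of "{0}" "poisson_pmf r"] by simp
    finally show ?thesis using False p0 e by simp
  qed
  then show ?thesis using False by (simp add: Po_def)
qed

lemma average_indicator_close_to_0:
  fixes N :: "'a \<Rightarrow> nat"
  assumes "finite X" "X \<noteq> {}"
  shows "\<bar>average X (\<lambda>t. indicator A (N t)) - indicator A 0\<bar> \<le> average X (\<lambda>t. real (N t))"
proof -
  have "average X (\<lambda>t. indicator A (N t)) - indicator A 0 =
      average X (\<lambda>t. indicator A (N t) - indicator A 0)"
    using assms by (simp add: average_diff average_const)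
  also have "\<bar>\<dots>\<bar> \<le> average X (\<lambda>t. \<bar>indicator A (N t) - indicator A 0\<bar>)" by (rule abs_average_le)
  also have "\<dots> \<le> average X (\<lambda>t. real (N t))"
  proof (rule average_mono)
    fix t
    show "\<bar>indicator A (N t) - indicator A 0\<bar> \<le> real (N t)"
      by (cases "N t") (auto simp: indicator_def)
  qed
  finally show ?thesis .
qed

text \<open>
  Beyond the range of \<open>stein_error_fringe_count\<close> the claim follows from the comparison of both sides with
  the point mass at 0, which gives \<open>2 * r\<close>; the factor 8 suffices for relative usages of at least 1/4.
\<close>

lemma average_indicator_fringe_count_Po:
  assumes M: "(\<Sum>x\<in>#M. int x - 1) = -1"
  shows "\<bar>average (trees_with M) (\<lambda>t. indicator A (fringe_count T t))
      - measure_pmf.prob (Po (mean_fringe_count T M)) A\<bar>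
    \<le> 8 * mean_fringe_count T M * relative_usage (mset (preorder_word T)) M"
proof -
  let ?r = "mean_fringe_count T M" and ?S = "relative_usage (mset (preorder_word T)) M"
  have r: "0 \<le> ?r" by (simp add: average_nonneg)
  have S0: "0 \<le> ?S" unfolding relative_usage_def by (intro sum_nonneg) auto
  have crude: "\<bar>average (trees_with M) (\<lambda>t. indicator A (fringe_count T t))
      - measure_pmf.prob (Po ?r) A\<bar> \<le> 2 * ?r"
    using average_indicator_close_to_0[OF finite_trees_with[OF M], of A "fringe_count T"]
      Po_close_to_0[OF r, of A] by linarith
  consider "?r = 0" | "0 < ?r" "?S \<le> 1 / 4" | "1 / 4 \<le> ?S" using r by linarith
  then show ?thesis
  proof cases
    case 1
    then show ?thesis using crude by simp
  next
    case 2
    then have "7 * ?r * ?S \<le> 8 * ?r * ?S" using S0 by (intro mult_right_mono) auto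
    then show ?thesis using stein_error_fringe_count[OF M 2, of A] 2 by (simp add: Po_def)
  next
    case 3
    have "2 * ?r = 8 * ?r * (1 / 4)" by simp
    also have "\<dots> \<le> 8 * ?r * ?S" using 3 r by (intro mult_left_mono) auto
    finally show ?thesis using crude by linarith
  qed
qed

lemma degree_statistic_multiset:
  assumes "degree_statistic ns"
  obtains M where "count M = ns" "size M = stat_size ns" "(\<Sum>x\<in>#M. int x - 1) = -1"
proof
  let ?M = "Abs_multiset ns"
  have fin: "finite {i. 0 < ns i}" and
    eq: "stat_size ns = 1 + (\<Sum>i\<in>stat_support ns. i * ns i)"
    using assms by (auto simp: degree_statistic_def stat_support_def)
  show c: "count ?M = ns" using fin by (rule count_Abs_multiset)
  have supp: "set_mset ?M = stat_support ns"
    by (auto simp: stat_support_def c set_mset_def)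
  show size: "size ?M = stat_size ns"
    by (simp add: size_multiset_overloaded_eq supp c stat_size_def)
  have wt: "sum_mset ?M = (\<Sum>i\<in>stat_support ns. i * ns i)"
  proof -
    obtain xs where xs: "mset xs = ?M" using ex_mset by blast
    have "sum_mset ?M = (\<Sum>x\<in>set xs. count_list xs x * x)"
      using sum_list_map_eq_sum_count[of "\<lambda>x. x" xs] by (simp flip: xs add: sum_mset_sum_list)
    also have "\<dots> = (\<Sum>i\<in>set_mset ?M. count ?M i * i)"
      by (simp flip: xs add: count_mset)
    finally show ?thesis by (simp add: supp c mult.commute)
  qed
  have "(\<Sum>x\<in>#N. int x - 1) = int (sum_mset N) - int (size N)" for N
    by (induction N) auto
  then have "(\<Sum>x\<in>#?M. int x - 1) = int (sum_mset ?M) - int (size ?M)" .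
  also have "\<dots> = -1" unfolding wt size eq by simp
  finally show "(\<Sum>x\<in>#?M. int x - 1) = -1" .
qed

lemma trees_with_stat_eq: "count M = ns \<Longrightarrow> trees_with_stat ns = trees_with M"
  by (auto simp: trees_with_stat_def trees_with_def multiset_eq_iff tree_stat_eq_count fun_eq_iff)

lemma degree_set_eq: "degree_set T = set_mset (mset (preorder_word T))"
  by (auto simp: degree_set_def tree_stat_eq_count)

lemma stat_size_tree_stat: "stat_size (tree_stat T) = tree_size T"
proof -
  have "stat_size (tree_stat T) = size (mset (preorder_word T))"
    unfolding size_multiset_overloaded_eq stat_size_def stat_support_def tree_stat_eq_count
    by (intro sum.cong) auto
  then show ?thesis by (simp add: tree_size_eq_length)
qed

lemma d_TV_least:
  assumes "\<And>A. \<bar>measure_pmf.prob p A - measure_pmf.prob q A\<bar> \<le> B"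
  shows "d_TV p q \<le> B"
  unfolding d_TV_def by (rule cSUP_least) (use assms in auto)

theorem theorem3p10:
  shows "\<exists>C :: real. \<forall>(ns :: nat \<Rightarrow> nat) (T :: plane_tree). degree_statistic ns \<longrightarrow>
    (let n = real (stat_size ns);
         m = real (tree_size T);
         lam = measure_pmf.expectation (random_tree ns) (\<lambda>t. real (fringe_count T t))
     in d_TV (map_pmf (fringe_count T) (random_tree ns)) (Po lam)
          \<le> C * lam * (\<Sum>i\<in>degree_set T. (real (tree_stat T i))\<^sup>2 / real (ns i))
      \<and> C * lam * (\<Sum>i\<in>degree_set T. (real (tree_stat T i))\<^sup>2 / real (ns i))
          = C * m\<^sup>2 * (lam / n) *
            (\<Sum>i\<in>degree_set T. (stat_prop (tree_stat T) i)\<^sup>2 / stat_prop ns i))"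
proof (intro exI[of _ 8] allI impI)
  fix ns T
  assume "degree_statistic ns"
  then obtain M where M: "count M = ns" "size M = stat_size ns" "(\<Sum>x\<in>#M. int x - 1) = -1"
    by (rule degree_statistic_multiset)
  define lam where "lam = measure_pmf.expectation (random_tree ns) (\<lambda>t. real (fringe_count T t))"
  define n m where "n = real (stat_size ns)" and "m = real (tree_size T)"
  define S where "S = (\<Sum>i\<in>degree_set T. (real (tree_stat T i))\<^sup>2 / real (ns i))"
  define S' where "S' = (\<Sum>i\<in>degree_set T. (stat_prop (tree_stat T) i)\<^sup>2 / stat_prop ns i)"
  note fin = finite_trees_with[OF M(3)]
  have rt: "random_tree ns = pmf_of_set (trees_with M)"
    by (simp add: random_tree_def trees_with_stat_eq[OF M(1)])
  have expect: "measure_pmf.expectation (random_tree ns) f = average (trees_with M) f" for f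
    unfolding rt average_def by (rule integral_pmf_of_set[OF fin(2,1)])
  have lam: "lam = mean_fringe_count T M" unfolding lam_def by (rule expect)
  have S: "S = relative_usage (mset (preorder_word T)) M"
    unfolding S_def relative_usage_def degree_set_eq M(1)[symmetric] tree_stat_eq_count ..
  have "d_TV (map_pmf (fringe_count T) (random_tree ns)) (Po lam) \<le> 8 * lam * S"
  proof (rule d_TV_least)
    fix A
    have "measure_pmf.prob (map_pmf (fringe_count T) (random_tree ns)) A =
        measure_pmf.expectation (random_tree ns) (indicator (fringe_count T -` A))"
      by simp
    also have "\<dots> = average (trees_with M) (\<lambda>t. indicator A (fringe_count T t))"
      unfolding expect by (intro average_cong) (simp add: indicator_def)
    finally show "\<bar>measure_pmf.prob (map_pmf (fringe_count T) (random_tree ns)) A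
        - measure_pmf.prob (Po lam) A\<bar> \<le> 8 * lam * S"
      using average_indicator_fringe_count_Po[OF M(3), of A T] by (simp add: lam S)
  qed
  moreover have "8 * lam * S = 8 * m\<^sup>2 * (lam / n) * S'"
  proof -
    have n: "0 < n" using size_pos_if_excess[OF M(3)] M(2) by (simp add: n_def)
    have m: "0 < m" by (simp add: m_def tree_size_eq_length)
    have "S' = (\<Sum>i\<in>degree_set T. n / m\<^sup>2 * ((real (tree_stat T i))\<^sup>2 / real (ns i)))"
      unfolding S'_def stat_prop_def stat_size_tree_stat n_def[symmetric] m_def[symmetric]
      by (simp add: power_divide field_simps)
    also have "\<dots> = n / m\<^sup>2 * S" by (simp add: S_def sum_distrib_left)
    finally show ?thesis using n m by simp
  qed
  ultimately show "let n = real (stat_size ns);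
         m = real (tree_size T);
         lam = measure_pmf.expectation (random_tree ns) (\<lambda>t. real (fringe_count T t))
     in d_TV (map_pmf (fringe_count T) (random_tree ns)) (Po lam)
          \<le> 8 * lam * (\<Sum>i\<in>degree_set T. (real (tree_stat T i))\<^sup>2 / real (ns i))
      \<and> 8 * lam * (\<Sum>i\<in>degree_set T. (real (tree_stat T i))\<^sup>2 / real (ns i))
          = 8 * m\<^sup>2 * (lam / n) *
            (\<Sum>i\<in>degree_set T. (stat_prop (tree_stat T) i)\<^sup>2 / stat_prop ns i)"
    unfolding Let_def lam_def n_def m_def S_def S'_def by blast
qed

end
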